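(* Let $0<\alpha<1$ and $s<-\frac12$. Then for any $b\in\mathbb{R}$ (and any $b'\in\mathbb{R}$) both of the following trilinear estimates fail to hold: $$\|(vw^2)_x\|_{X_{s,b'}}\lesssim\|v\|_{X_{s,b}}\,\|w\|_{X^\alpha_{s,b}}^2,$$ $$\|(v^2w)_x\|_{X^\alpha_{s,b'}}\lesssim\|v\|_{X_{s,b}}^2\,\|w\|_{X^\alpha_{s,b}}.$$ That is, for neither of the two inequalities does there exist a finite constant $C$ such that the inequality, with $\lesssim$ replaced by $\le C\,\cdot$, holds for all Schwartz functions $v,w$ on $\mathbb{R}^2$.
   Context: Write $\langle\xi\rangle=1+|\xi|$ and $\widetilde f(\xi,\tau)=c\int_{\mathbb{R}^2}e^{-i(x\xi+t\tau)}f(x,t)\,dx\,dt$ for the space-time Fourier transform. For $s,b\in\mathbb{R}$, $X_{s,b}$ (also written $X^1_{s,b}$) and $X^\alpha_{s,b}$ are the completions of the Schwartz functions on $\mathbb{R}^2$ under the norms $$\|f\|_{X_{s,b}}=\|\langle\tau-\xi^3\rangle^b\langle\xi\rangle^s\widetilde f(\xi,\tau)\|_{L^2_{\xi,\tau}},\qquad \|f\|_{X^\alpha_{s,b}}=\|\langle\tau-\alpha\xi^3\rangle^b\langle\xi\rangle^s\widetilde f(\xi,\tau)\|_{L^2_{\xi,\tau}}.$$ The subscript $x$ on $(\cdot)_x$ denotes $\partial_x$. *)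

theory Defs
  imports "HOL-Analysis.Analysis"
begin

text \<open>A point of space-time is a pair whose first component is the space variable and whose
  second component is the time variable; its dual variables are written \<open>\<xi>\<close> and \<open>\<tau>\<close>.\<close>

definition partial_x :: "(real \<times> real \<Rightarrow> complex) \<Rightarrow> real \<times> real \<Rightarrow> complex" where
  "partial_x f = (\<lambda>(x, t). vector_derivative (\<lambda>y. f (y, t)) (at x))"

definition partial_t :: "(real \<times> real \<Rightarrow> complex) \<Rightarrow> real \<times> real \<Rightarrow> complex" where
  "partial_t f = (\<lambda>(x, t). vector_derivative (\<lambda>r. f (x, r)) (at t))"

definition iterated_partial ::
  "nat \<Rightarrow> nat \<Rightarrow> (real \<times> real \<Rightarrow> complex) \<Rightarrow> real \<times> real \<Rightarrow> complex" where
  "iterated_partial j k f = (partial_x ^^ j) ((partial_t ^^ k) f)"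

text \<open>Differentiability of every \<open>\<partial>\<^sub>x\<^sup>j \<partial>\<^sub>t\<^sup>k f\<close>
  at every point (in the Frechet sense, as a function of two variables) makes these functions
  continuous and the mixed partial derivatives symmetric, so it is equivalent to \<open>f\<close> being
  smooth.\<close>

definition smooth2 :: "(real \<times> real \<Rightarrow> complex) \<Rightarrow> bool" where
  "smooth2 f \<longleftrightarrow> (\<forall>j k p. iterated_partial j k f differentiable (at p))"

definition schwartz :: "(real \<times> real \<Rightarrow> complex) \<Rightarrow> bool" where
  "schwartz f \<longleftrightarrow> smooth2 f \<and>
     (\<forall>m n j k. \<exists>B. \<forall>x t. norm (of_real (x ^ m * t ^ n) * iterated_partial j k f (x, t)) \<le> B)"

text \<open>The normalising constant \<open>c\<close> of the Fourier transform is a parameter.\<close>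

definition fourier2 :: "complex \<Rightarrow> (real \<times> real \<Rightarrow> complex) \<Rightarrow> real \<times> real \<Rightarrow> complex" where
  "fourier2 c f = (\<lambda>(\<xi>, \<tau>).
     c * (LINT (x, t)|lborel. exp (- \<i> * of_real (x * \<xi> + t * \<tau>)) * f (x, t)))"

definition jbracket :: "real \<Rightarrow> real" where
  "jbracket \<xi> = 1 + \<bar>\<xi>\<bar>"

text \<open>The norm of \<open>X\<^sup>\<alpha>\<^bsub>s,b\<^esub>\<close> on Schwartz functions; \<open>\<alpha> = 1\<close> gives
  \<open>X\<^bsub>s,b\<^esub>\<close>. The Fourier transform of a Schwartz function is again a Schwartz function and
  the weights grow at most polynomially, so the integrand is integrable and the default value 0
  of the Bochner integral plays no role there.\<close>

definition X_norm ::
  "complex \<Rightarrow> real \<Rightarrow> real \<Rightarrow> real \<Rightarrow> (real \<times> real \<Rightarrow> complex) \<Rightarrow> real" where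
  "X_norm c \<alpha> s b f = sqrt (LINT (\<xi>, \<tau>)|lborel.
     (norm (of_real (jbracket (\<tau> - \<alpha> * \<xi> ^ 3) powr b * jbracket \<xi> powr s)
            * fourier2 c f (\<xi>, \<tau>)))\<^sup>2)"

end

theory Submission
  imports Defs "HOL-Probability.Probability" "HOL-Real_Asymp.Real_Asymp"
begin

text \<open>Both estimates are defeated by the trivial resonance \<open>N = N + N - N\<close>. Let one factor be a
  Gaussian wave packet at the point \<open>(N, \<beta> N\<^sup>3)\<close> of the curve \<open>\<tau> = \<beta> \<xi>\<^sup>3\<close>,
  and let the squared factor be the sum of two packets at \<open>\<plusminus>(N, \<gamma> N\<^sup>3)\<close>.
  Taking the packets of width \<open>N\<^sup>-\<^sup>2\<close> in \<open>\<xi>\<close> and \<open>1\<close> in \<open>\<tau>\<close> keeps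
  \<open>\<tau> - \<beta> \<xi>\<^sup>3\<close> (respectively \<open>\<tau> - \<gamma> \<xi>\<^sup>3\<close>) bounded on them, so the exponents
  \<open>b, b'\<close> are irrelevant and each factor has norm \<open>O(N\<^sup>s\<^sup>+\<^sup>1)\<close>. The product contains a
  packet at \<open>(N, \<beta> N\<^sup>3)\<close>; as all packets have nonnegative Fourier transforms (up to the constant
  \<open>c\<close>), nothing cancels it, and the derivative of the product has norm at least of order
  \<open>N\<^sup>s\<^sup>+\<^sup>2\<close>. Since \<open>s < -1/2\<close>, this eventually exceeds every multiple of
  \<open>N\<^sup>3\<^sup>s\<^sup>+\<^sup>3\<close>.\<close>

section \<open>Real Gaussian integrals and the absorption of polynomials by Gaussians\<close>

lemma has_bochner_integral_gaussian:
  fixes a m :: real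
  assumes "a > 0"
  shows "has_bochner_integral lborel (\<lambda>x. exp (- (a * (x - m)\<^sup>2) / 2)) (sqrt (2 * pi / a))"
proof -
  have eq: "exp (- (a * (x - m)\<^sup>2) / 2) = sqrt (2 * pi / a) * normal_density m (1 / sqrt a) x" for x
    using assms by (simp add: normal_density_def field_simps real_sqrt_divide)
  have "has_bochner_integral lborel (normal_density m (1 / sqrt a)) 1"
    using assms by (simp add: has_bochner_integral_iff)
  from has_bochner_integral_mult_right[OF this, of "sqrt (2 * pi / a)"]
  show ?thesis unfolding eq[abs_def] by simp
qed

text \<open>A single term of the exponential series bounds a power by \<open>exp (r * y)\<close>,
  and a linear exponent is dominated by a quadratic one up to a constant. Later, every polynomial
  loss is paid for in this way out of Gaussian decay.\<close>

lemma power_le_exp_square: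
  fixes q :: real
  assumes "q > 0"
  obtains K where "K > 0" "\<And>x. (1 + \<bar>x\<bar>) ^ m \<le> K * exp (q * x\<^sup>2)"
proof
  \<comment> \<open>With \<open>r \<le> q / 4\<close> and y at least 1, the linear exponent
    \<open>r * y\<close> is at most \<open>q * y\<^sup>2 / 4\<close>.\<close>
  define r where "r = min 1 (q / 4)"
  have r: "0 < r" "r \<le> 1" "r \<le> q / 4" using assms by (auto simp: r_def)
  let ?K = "fact m / r ^ m * exp (2 * q)"
  show "?K > 0" using r by simp
  fix x :: real
  define y where "y = 1 + \<bar>x\<bar>"
  have y: "y \<ge> 1" by (simp add: y_def)
  have "(r * y) ^ m / fact m \<le> exp (r * y)"
  proof -
    have "(\<Sum>n\<in>{m}. (r * y) ^ n /\<^sub>R fact n) \<le> (\<Sum>n. (r * y) ^ n /\<^sub>R fact n)"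
      using r y by (intro sum_le_suminf summable_exp_generic) auto
    then show ?thesis by (simp add: exp_def field_simps)
  qed
  also have "\<dots> \<le> exp (2 * q + q * x\<^sup>2)"
  proof -
    have "r * y \<le> q * y\<^sup>2 / 4"
    proof -
      have "r * y \<le> q / 4 * y" using r y by (intro mult_right_mono) auto
      also have "\<dots> \<le> q / 4 * (y * y)" using assms y by (intro mult_left_mono) auto
      finally show ?thesis by (simp add: power2_eq_square)
    qed
    also have "y\<^sup>2 \<le> 2 + 2 * x\<^sup>2"
      using zero_le_power2[of "1 - \<bar>x\<bar>"] by (simp add: y_def power2_eq_square algebra_simps)
    then have "q * y\<^sup>2 / 4 \<le> q * (2 + 2 * x\<^sup>2) / 4" using assms by simp
    also have "\<dots> \<le> 2 * q + q * x\<^sup>2" using assms by (simp add: field_simps)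
    finally show ?thesis by simp
  qed
  finally have "r ^ m * y ^ m \<le> fact m * (exp (2 * q) * exp (q * x\<^sup>2))"
    by (simp add: field_simps exp_add power_mult_distrib)
  then show "(1 + \<bar>x\<bar>) ^ m \<le> ?K * exp (q * x\<^sup>2)" using r by (simp add: y_def field_simps)
qed

subsection \<open>One-dimensional modulated Gaussians\<close>

text \<open>Here a is the inverse square of the width and A the frequency. Multiplying two such
  functions adds both parameters, so products of packets stay explicit.\<close>

definition gauss :: "real \<Rightarrow> real \<Rightarrow> real \<Rightarrow> complex" where
  "gauss a A x = exp (of_real (- (a * x\<^sup>2) / 2) + \<i> * of_real (A * x))"

lemma norm_gauss: "norm (gauss a A x) = exp (- (a * x\<^sup>2) / 2)"
  by (simp add: gauss_def)

lemma gauss_mult: "gauss a A x * gauss b B x = gauss (a + b) (A + B) x"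
  unfolding gauss_def exp_add[symmetric]
  by (rule arg_cong[of _ _ exp]) (simp add: field_simps)

lemma continuous_on_gauss [continuous_intros]:
  "continuous_on S f \<Longrightarrow> continuous_on S (\<lambda>x. gauss a A (f x))"
  unfolding gauss_def by (intro continuous_intros) auto

lemma borel_measurable_gauss [measurable]: "gauss a A \<in> borel_measurable borel"
  by (intro borel_measurable_continuous_onI continuous_intros)

text \<open>The function is the restriction to the real line of an entire function, whose complex
  derivative is restricted along with it.\<close>

lemma gauss_has_vector_derivative:
  "(gauss a A has_vector_derivative (of_real (- a * x) + \<i> * of_real A) * gauss a A x) (at x within S)"
proof -
  have "((\<lambda>z. exp (- (of_real a * z\<^sup>2) / 2 + \<i> * (of_real A * z))) has_field_derivative
      (- of_real a * of_real x + \<i> * of_real A) *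
        exp (- (of_real a * (of_real x)\<^sup>2) / 2 + \<i> * (of_real A * of_real x)))
      (at (of_real x))"
    by (auto intro!: derivative_eq_intros simp: algebra_simps)
  from has_vector_derivative_real_field[OF this]
  show ?thesis
    unfolding gauss_def by (simp add: o_def)
qed

text \<open>Half of the Gaussian exponent absorbs the polynomial; the other half is still an
  integrable Gaussian.\<close>

lemma integrable_power_gauss:
  assumes "a > 0"
  shows "integrable lborel (\<lambda>x. of_real (x ^ m) * gauss a A x)"
proof -
  obtain K where K: "K > 0" "\<And>x. (1 + \<bar>x\<bar>) ^ m \<le> K * exp (a / 4 * x\<^sup>2)"
    using power_le_exp_square[of "a / 4"] assms by auto
  show ?thesis
  proof (rule Bochner_Integration.integrable_bound)
    show "integrable lborel (\<lambda>x. K * exp (- (a / 2 * (x - 0)\<^sup>2) / 2))"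
      using has_bochner_integral_gaussian[of "a / 2" 0] assms
      by (intro integrable_mult_right) (auto simp: has_bochner_integral_iff)
    show "AE x in lborel. norm (of_real (x ^ m) * gauss a A x)
            \<le> norm (K * exp (- (a / 2 * (x - 0)\<^sup>2) / 2))"
    proof (rule AE_I2)
      fix x :: real
      have "norm (of_real (x ^ m) * gauss a A x) = \<bar>x\<bar> ^ m * exp (- (a * x\<^sup>2) / 2)"
        by (simp add: norm_mult norm_gauss power_abs norm_power)
      also have "\<dots> \<le> (K * exp (a / 4 * x\<^sup>2)) * exp (- (a * x\<^sup>2) / 2)"
        by (intro mult_right_mono order_trans[OF _ K(2)] power_mono) auto
      also have "\<dots> = K * exp (- (a / 2 * (x - 0)\<^sup>2) / 2)"
        by (simp add: exp_add[symmetric] field_simps)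
      finally show "norm (of_real (x ^ m) * gauss a A x) \<le> norm (K * exp (- (a / 2 * (x - 0)\<^sup>2) / 2))"
        using K(1) by simp
    qed
  qed simp
qed

lemma integrable_gauss: "a > 0 \<Longrightarrow> integrable lborel (gauss a A)"
  using integrable_power_gauss[of a 0 A] by simp

text \<open>After rescaling by \<open>\<sigma> = 1 / sqrt a\<close> the integral becomes a multiple
  of the characteristic function of the standard normal distribution at \<open>A * \<sigma>\<close>,
  whose value is known.\<close>

lemma integral_gauss:
  assumes "a > 0"
  shows "(LINT x|lborel. gauss a A x) = of_real (sqrt (2 * pi / a) * exp (- A\<^sup>2 / (2 * a)))"
proof -
  define \<sigma> where "\<sigma> = 1 / sqrt a"
  have \<sigma>: "\<sigma> > 0" "a * \<sigma>\<^sup>2 = 1" using assms by (auto simp: \<sigma>_def power_divide)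
  have "(LINT x|lborel. gauss a A x) = \<sigma> *\<^sub>R (LINT x|lborel. gauss a A (0 + \<sigma> * x))"
    using lborel_integral_real_affine[of \<sigma> "gauss a A" 0] \<sigma> by simp
  also have "(\<lambda>x. gauss a A (0 + \<sigma> * x)) =
      (\<lambda>x. of_real (sqrt (2 * pi)) * (std_normal_density x *\<^sub>R iexp ((A * \<sigma>) * x)))"
  proof
    fix x
    have "- (a * (\<sigma> * x)\<^sup>2) / 2 = - x\<^sup>2 / 2" using \<sigma> by (simp add: power_mult_distrib mult.assoc[symmetric])
    then show "gauss a A (0 + \<sigma> * x) = of_real (sqrt (2 * pi)) * (std_normal_density x *\<^sub>R iexp ((A * \<sigma>) * x))"
      unfolding gauss_def
      by (simp add: std_normal_density_def scaleR_conv_of_real exp_add mult.assoc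
           flip: exp_of_real) (simp add: algebra_simps exp_add[symmetric])
  qed
  also have "(LINT x|lborel. of_real (sqrt (2 * pi)) * (std_normal_density x *\<^sub>R iexp ((A * \<sigma>) * x)))
      = of_real (sqrt (2 * pi)) * char std_normal_distribution (A * \<sigma>)"
    unfolding char_def
    by (subst integral_density) (auto simp: mult_scaleR_right simp flip: integral_mult_right_zero)
  also have "\<sigma> *\<^sub>R \<dots> = of_real (sqrt (2 * pi / a) * exp (- A\<^sup>2 / (2 * a)))"
    unfolding char_std_normal_distribution
    by (simp add: \<sigma>_def power_mult_distrib power_divide assms less_imp_le scaleR_conv_of_real real_sqrt_divide
        flip: exp_of_real) (simp add: mult.commute)
  finally show ?thesis .
qed

text \<open>The Fourier kernel only shifts the frequency, so \<open>integral_gauss\<close> evaluates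
  the one-dimensional Fourier transform at every \<xi>.\<close>

lemma exp_mult_gauss: "exp (- \<i> * of_real (x * \<xi>)) * gauss a A x = gauss a (A - \<xi>) x"
  by (simp add: gauss_def exp_add[symmetric] algebra_simps)

lemma gauss_tendsto_0:
  assumes "a > 0" and "F = at_top \<or> F = at_bot"
  shows "(gauss a A \<longlongrightarrow> 0) F"
proof (rule tendsto_norm_zero_cancel)
  have "((\<lambda>x. exp (- (a * x\<^sup>2) / 2)) \<longlongrightarrow> 0) F"
    using assms(2) by (elim disjE; hypsubst) (use assms(1) in real_asymp)+
  then show "((\<lambda>x. norm (gauss a A x)) \<longlongrightarrow> 0) F" by (simp add: norm_gauss)
qed

lemma integrable_deriv_gauss:
  assumes "a > 0"
  shows "integrable lborel (\<lambda>x. (of_real (- a * x) + \<i> * of_real A) * gauss a A x)"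
proof -
  have "integrable lborel (\<lambda>x. of_real (- a) * (of_real (x ^ 1) * gauss a A x) + \<i> * of_real A * (of_real (x ^ 0) * gauss a A x))"
    using assms by (intro Bochner_Integration.integrable_add integrable_mult_right integrable_power_gauss)
  then show ?thesis by (simp add: algebra_simps)
qed

text \<open>The integrand is the derivative of \<open>gauss a A\<close>, which vanishes at both
  infinities. This supplies the integration by parts that turns the space derivative into
  multiplication by \<xi>.\<close>

lemma integral_deriv_gauss:
  assumes "a > 0"
  shows "(LINT x|lborel. (of_real (- a * x) + \<i> * of_real A) * gauss a A x) = 0"
proof -
  have "(LBINT x=-\<infinity>..\<infinity>. (of_real (- a * x) + \<i> * of_real A) * gauss a A x) = 0 - 0"
  proof (rule interval_integral_FTC_integrable)
    show "isCont (\<lambda>x. (of_real (- a * x) + \<i> * of_real A) * gauss a A x) x" for x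
    proof -
      have "continuous_on UNIV (\<lambda>x. (of_real (- a * x) + \<i> * of_real A) * gauss a A x)"
        by (intro continuous_intros)
      then show ?thesis by (simp add: continuous_on_eq_continuous_at)
    qed
    show "set_integrable lborel (einterval (-\<infinity>) \<infinity>) (\<lambda>x. (of_real (- a * x) + \<i> * of_real A) * gauss a A x)"
      using integrable_deriv_gauss[OF assms, of A] by (simp add: set_integrable_def einterval_eq_UNIV)
    show "((gauss a A \<circ> real_of_ereal) \<longlongrightarrow> 0) (at_right (-\<infinity>))"
      using gauss_tendsto_0[OF assms, of at_bot A]
      by (simp add: ereal_tendsto_simps1 del: o_apply comp_apply)
    show "((gauss a A \<circ> real_of_ereal) \<longlongrightarrow> 0) (at_left \<infinity>)"
      using gauss_tendsto_0[OF assms, of at_top A]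
      by (simp add: ereal_tendsto_simps1 del: o_apply comp_apply)
  qed (use gauss_has_vector_derivative in auto)
  then show ?thesis by (simp add: einterval_eq_UNIV set_lebesgue_integral_def
      interval_lebesgue_integral_def)
qed

lemma
  fixes f g :: "real \<Rightarrow> 'a :: {real_normed_field, banach, second_countable_topology}"
  assumes f: "integrable lborel f" and g: "integrable lborel g"
  shows integrable_lborel_times: "integrable lborel (\<lambda>p. f (fst p) * g (snd p))"
    and integral_lborel_times:
      "(LINT p|lborel. f (fst p) * g (snd p)) = (LINT x|lborel. f x) * (LINT y|lborel. g y)"
proof -
  note [measurable] = borel_measurable_integrable[OF f, simplified] borel_measurable_integrable[OF g, simplified]
  have *: "integrable (lborel \<Otimes>\<^sub>M lborel) (\<lambda>p. f (fst p) * g (snd p))"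
    using f g by (intro lborel_pair.Fubini_integrable) (auto simp: norm_mult)
  then show "integrable lborel (\<lambda>p. f (fst p) * g (snd p))" by (simp add: lborel_prod)
  show "(LINT p|lborel. f (fst p) * g (snd p)) = (LINT x|lborel. f x) * (LINT y|lborel. g y)"
    using lborel_pair.integral_fst'[OF *] f g by (simp add: lborel_prod)
qed

subsection \<open>Wave packets\<close>

lemma exp_mult_integrable:
  fixes f :: "real \<times> real \<Rightarrow> complex"
  assumes "integrable lborel f"
  shows "integrable lborel (\<lambda>(x, t). exp (- \<i> * of_real (x * \<xi> + t * \<tau>)) * f (x, t))"
proof (rule Bochner_Integration.integrable_bound[OF assms])
  have [measurable]: "f \<in> borel_measurable borel" using assms by simp
  have [measurable]: "fst \<in> borel_measurable (borel :: (real \<times> real) measure)"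
    "snd \<in> borel_measurable (borel :: (real \<times> real) measure)"
    by (intro borel_measurable_continuous_onI continuous_intros)+
  show "(\<lambda>(x, t). exp (- \<i> * of_real (x * \<xi> + t * \<tau>)) * f (x, t)) \<in> borel_measurable lborel"
    unfolding case_prod_unfold prod.collapse measurable_lborel1 by measurable
qed (auto simp: norm_mult)

lemma fourier2_add:
  assumes "integrable lborel f" "integrable lborel g"
  shows "fourier2 c (\<lambda>p. f p + g p) q = fourier2 c f q + fourier2 c g q"
proof -
  obtain \<xi> \<tau> where q: "q = (\<xi>, \<tau>)" by force
  show ?thesis
    using Bochner_Integration.integral_add[OF exp_mult_integrable[OF assms(1), of \<xi> \<tau>] exp_mult_integrable[OF assms(2), of \<xi> \<tau>]]
    by (simp add: q fourier2_def algebra_simps case_prod_unfold)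
qed

lemma fourier2_cmult: "fourier2 c (\<lambda>p. k * f p) q = k * fourier2 c f q"
  by (simp add: fourier2_def case_prod_unfold mult.left_commute[of _ k])

lemma fourier2_times:
  assumes u: "integrable lborel u" and v: "integrable lborel v"
  shows "fourier2 c (\<lambda>p. u (fst p) * v (snd p)) (\<xi>, \<tau>) =
     c * ((LINT x|lborel. exp (- \<i> * of_real (x * \<xi>)) * u x) * (LINT t|lborel. exp (- \<i> * of_real (t * \<tau>)) * v t))"
proof -
  have 1: "integrable lborel (\<lambda>x. exp (- \<i> * of_real (x * \<xi>)) * u x)" if "integrable lborel u" for u \<xi>
  proof (rule Bochner_Integration.integrable_bound[OF that])
    have [measurable]: "u \<in> borel_measurable borel" using that by simp
    show "(\<lambda>x. exp (- \<i> * of_real (x * \<xi>)) * u x) \<in> borel_measurable lborel" by measurable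
  qed (auto simp: norm_mult)
  have split: "exp (- \<i> * of_real (x * \<xi> + t * \<tau>)) = exp (- \<i> * of_real (x * \<xi>)) * exp (- \<i> * of_real (t * \<tau>))" for x t
    by (simp add: exp_add[symmetric] distrib_left)
  show ?thesis
    unfolding integral_lborel_times[OF 1[OF u] 1[OF v], symmetric] fourier2_def case_prod_unfold fst_conv snd_conv split
    by (simp only: mult_ac)
qed

text \<open>On the Fourier side this is centred at (A, B) with widths sqrt a in \<xi> and sqrt d in
  \<tau>; thus a = 1 / N^4 gives the width N^-2.\<close>

definition packet :: "real \<Rightarrow> real \<Rightarrow> real \<Rightarrow> real \<Rightarrow> real \<times> real \<Rightarrow> complex" where
  "packet a d A B = (\<lambda>p. gauss a A (fst p) * gauss d B (snd p))"

text \<open>Real-valued, with the constant c split off, so that its nonnegativity can be used to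
  exclude cancellation between packets.\<close>

definition packet_hat :: "real \<Rightarrow> real \<Rightarrow> real \<Rightarrow> real \<Rightarrow> real \<times> real \<Rightarrow> real" where
  "packet_hat a d A B = (\<lambda>(\<xi>, \<tau>). (sqrt (2 * pi / a) * exp (- (\<xi> - A)\<^sup>2 / (2 * a))) *
     (sqrt (2 * pi / d) * exp (- (\<tau> - B)\<^sup>2 / (2 * d))))"

lemma packet_mult: "packet a d A B p * packet a' d' A' B' p = packet (a + a') (d + d') (A + A') (B + B') p"
proof -
  have "packet a d A B p * packet a' d' A' B' p =
      (gauss a A (fst p) * gauss a' A' (fst p)) * (gauss d B (snd p) * gauss d' B' (snd p))"
    by (simp add: packet_def)
  then show ?thesis by (simp only: gauss_mult packet_def)
qed

lemma integrable_packet: "a > 0 \<Longrightarrow> d > 0 \<Longrightarrow> integrable lborel (packet a d A B)"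
  unfolding packet_def by (intro integrable_lborel_times integrable_gauss)

lemma fourier2_packet:
  assumes "a > 0" "d > 0"
  shows "fourier2 c (packet a d A B) q = c * of_real (packet_hat a d A B q)"
proof -
  obtain \<xi> \<tau> where q: "q = (\<xi>, \<tau>)" by force
  show ?thesis
    unfolding q packet_def fourier2_times[OF integrable_gauss[OF assms(1)] integrable_gauss[OF assms(2)]]
      exp_mult_gauss integral_gauss[OF assms(1)] integral_gauss[OF assms(2)] packet_hat_def
    by (simp add: power2_commute)
qed

lemma packet_has_vector_derivative:
  "((\<lambda>y. packet a d A B (y, t)) has_vector_derivative
     (of_real (- a * x) + \<i> * of_real A) * packet a d A B (x, t)) (at x)"
  unfolding packet_def fst_conv snd_conv mult.assoc[symmetric]
  by (intro has_vector_derivative_mult_left gauss_has_vector_derivative)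

lemma partial_x_eqI:
  "(\<And>x t. ((\<lambda>y. f (y, t)) has_vector_derivative g (x, t)) (at x)) \<Longrightarrow> partial_x f = g"
  by (force simp: partial_x_def intro!: ext vector_derivative_at)

lemma partial_t_eqI:
  "(\<And>x t. ((\<lambda>y. f (x, y)) has_vector_derivative g (x, t)) (at t)) \<Longrightarrow> partial_t f = g"
  by (force simp: partial_t_def intro!: ext vector_derivative_at)

lemma partial_x_packet:
  "partial_x (packet a d A B) =
     (\<lambda>p. ((of_real (- a * fst p) + \<i> * of_real A) * gauss a A (fst p)) * gauss d B (snd p))"
  by (rule partial_x_eqI)
    (use packet_has_vector_derivative[of a d A B] in \<open>simp add: packet_def mult.assoc\<close>)

lemma integrable_partial_x_packet: "a > 0 \<Longrightarrow> d > 0 \<Longrightarrow> integrable lborel (partial_x (packet a d A B))"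
  unfolding partial_x_packet
  by (intro integrable_lborel_times integrable_deriv_gauss integrable_gauss)

text \<open>Once the kernel has shifted the frequency to A - \<xi>, the integrand is the derivative
  of a Gaussian, with integral 0, plus \<open>\<i> * \<xi>\<close> times that Gaussian.\<close>

lemma fourier2_partial_x_packet:
  assumes "a > 0" "d > 0"
  shows "fourier2 c (partial_x (packet a d A B)) (\<xi>, \<tau>) =
    \<i> * of_real \<xi> * c * of_real (packet_hat a d A B (\<xi>, \<tau>))"
proof -
  have eq: "exp (- \<i> * of_real (x * \<xi>)) * ((of_real (- a * x) + \<i> * of_real A) * gauss a A x) =
     (of_real (- a * x) + \<i> * of_real (A - \<xi>)) * gauss a (A - \<xi>) x + \<i> * of_real \<xi> * gauss a (A - \<xi>) x" for x
  proof -
    have "exp (- \<i> * of_real (x * \<xi>)) * ((of_real (- a * x) + \<i> * of_real A) * gauss a A x) =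
       (of_real (- a * x) + \<i> * of_real A) * (exp (- \<i> * of_real (x * \<xi>)) * gauss a A x)"
      by (simp only: mult.left_commute)
    then show ?thesis unfolding exp_mult_gauss by (simp add: algebra_simps)
  qed
  have "(LINT x|lborel. exp (- \<i> * of_real (x * \<xi>)) * ((of_real (- a * x) + \<i> * of_real A) * gauss a A x)) =
     \<i> * of_real \<xi> * (LINT x|lborel. gauss a (A - \<xi>) x)"
    unfolding eq using assms
      Bochner_Integration.integral_add[OF integrable_deriv_gauss[OF assms(1)]
        integrable_mult_right[OF integrable_gauss[OF assms(1)]], of "A - \<xi>" "\<i> * of_real \<xi>" "A - \<xi>"]
    by (simp only: integral_deriv_gauss integral_mult_right_zero add_0_left)
  then show ?thesis
    unfolding partial_x_packet
      fourier2_times[OF integrable_deriv_gauss[OF assms(1)] integrable_gauss[OF assms(2)]]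
      exp_mult_gauss integral_gauss[OF assms(1)] integral_gauss[OF assms(2)] packet_hat_def
    by (simp add: power2_commute)
qed

subsection \<open>A class of Schwartz functions\<close>

text \<open>Packets alone are not closed under differentiation. Allowing polynomial factors and
  finite sums gives a class stable under both partial derivatives, so the Schwartz conditions reduce
  to differentiability and boundedness of its members.\<close>

inductive_set gauss_poly :: "(real \<times> real \<Rightarrow> complex) set" where
  monom: "a > 0 \<Longrightarrow> d > 0 \<Longrightarrow>
    (\<lambda>p. C * of_real (fst p ^ m) * of_real (snd p ^ n) * packet a d A B p) \<in> gauss_poly"
| add: "f \<in> gauss_poly \<Longrightarrow> g \<in> gauss_poly \<Longrightarrow> (\<lambda>p. f p + g p) \<in> gauss_poly"

lemma packet_in_gauss_poly: "a > 0 \<Longrightarrow> d > 0 \<Longrightarrow> packet a d A B \<in> gauss_poly"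
  using gauss_poly.monom[of a d 1 0 0 A B] by simp

text \<open>Rapid decay thereby becomes plain boundedness, since the polynomial weight is absorbed
  into the class.\<close>

lemma gauss_poly_mult_monom:
  assumes "f \<in> gauss_poly"
  shows "(\<lambda>p. of_real (fst p ^ m * snd p ^ n) * f p) \<in> gauss_poly"
  using assms
proof induction
  case (monom a d C i j A B)
  from gauss_poly.monom[OF this, of C "m + i" "n + j" A B] show ?case
    by (simp add: power_add mult_ac)
next
  case (add f g)
  from gauss_poly.add[OF add.IH] show ?case by (simp add: algebra_simps)
qed

lemma gauss_poly_bounded:
  assumes "f \<in> gauss_poly"
  shows "\<exists>K. \<forall>p. norm (f p) \<le> K"
  using assms
proof induction
  case (monom a d C m n A B)
  \<comment> \<open>The rate \<open>a / 2\<close> is the full decay rate of the Gaussian: for a mere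
    bound, nothing has to be left over.\<close>
  obtain K where K: "K > 0" "\<And>x. (1 + \<bar>x\<bar>) ^ m \<le> K * exp (a / 2 * x\<^sup>2)"
    using power_le_exp_square[of "a / 2"] monom by auto
  obtain L where L: "L > 0" "\<And>x. (1 + \<bar>x\<bar>) ^ n \<le> L * exp (d / 2 * x\<^sup>2)"
    using power_le_exp_square[of "d / 2"] monom by auto
  have 1: "\<bar>x\<bar> ^ m * exp (- (a * x\<^sup>2) / 2) \<le> K" if "\<And>x. (1 + \<bar>x\<bar>) ^ m \<le> K * exp (a / 2 * x\<^sup>2)"
    for x K a :: real and m
  proof -
    have "\<bar>x\<bar> ^ m \<le> (1 + \<bar>x\<bar>) ^ m" by (intro power_mono) auto
    also have "\<dots> \<le> K * exp (a / 2 * x\<^sup>2)" by (rule that)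
    finally have "\<bar>x\<bar> ^ m * exp (- (a * x\<^sup>2) / 2) \<le> K * exp (a / 2 * x\<^sup>2) * exp (- (a * x\<^sup>2) / 2)"
      by (rule mult_right_mono) simp
    also have "\<dots> = K" by (simp add: exp_add[symmetric])
    finally show ?thesis .
  qed
  show ?case
  proof (intro exI allI)
    fix p :: "real \<times> real"
    have "norm (C * of_real (fst p ^ m) * of_real (snd p ^ n) * packet a d A B p) =
       norm C * ((\<bar>fst p\<bar> ^ m * exp (- (a * (fst p)\<^sup>2) / 2)) * (\<bar>snd p\<bar> ^ n * exp (- (d * (snd p)\<^sup>2) / 2)))"
      by (simp add: packet_def norm_mult norm_gauss norm_power power_abs)
    also have "\<dots> \<le> norm C * (K * L)"
      using K L by (intro mult_left_mono mult_mono 1) auto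
    finally show "norm (C * of_real (fst p ^ m) * of_real (snd p ^ n) * packet a d A B p) \<le> norm C * (K * L)" .
  qed
next
  case (add f g)
  then obtain K L where "\<And>p. norm (f p) \<le> K" "\<And>p. norm (g p) \<le> L" by blast
  then have "norm (f p + g p) \<le> K + L" for p by (meson norm_triangle_le add_mono)
  then show ?case by blast
qed

lemma of_real_power_has_vector_derivative:
  "((\<lambda>y. complex_of_real (y ^ m)) has_vector_derivative of_real (real m * x ^ (m - 1))) (at x)"
proof -
  have "((\<lambda>y. y ^ m) has_real_derivative real m * x ^ (m - 1)) (at x)"
    by (auto intro!: derivative_eq_intros)
  then show ?thesis by (rule has_vector_derivative_of_real)
qed

lemma gauss_poly_differentiable:
  assumes "f \<in> gauss_poly"
  shows "f differentiable (at p)"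
  using assms
proof induction
  case (monom a d C m n A B)
  have g: "gauss a A differentiable (at x)" for a A x
    using gauss_has_vector_derivative[of a A x UNIV] by (auto simp: differentiable_def has_vector_derivative_def)
  have m: "(\<lambda>x. complex_of_real (x ^ m)) differentiable (at x)" for m x
    using of_real_power_has_vector_derivative[of m x] by (auto simp: differentiable_def has_vector_derivative_def)
  have 1: "(\<lambda>p. u (fst p)) differentiable (at p)" "(\<lambda>p. u (snd p)) differentiable (at p)"
    if "\<And>x. u differentiable (at x)" for u :: "real \<Rightarrow> complex"
    using differentiable_chain_at[of fst p u] differentiable_chain_at[of snd p u] that
    by (simp_all add: o_def bounded_linear_imp_differentiable bounded_linear_fst bounded_linear_snd)
  show ?case unfolding packet_def
    by (intro differentiable_mult differentiable_const 1 g m)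
qed (rule differentiable_add)

text \<open>The induction carries derivative witnesses instead of \<open>partial_x f\<close> and
  \<open>partial_t f\<close>, because \<open>vector_derivative\<close> respects sums only where
  derivatives are known to exist. Each monomial yields three: one from the power, one from the
  decay, one from the modulation.\<close>

lemma gauss_poly_partials:
  assumes "f \<in> gauss_poly"
  shows "(\<exists>g\<in>gauss_poly. \<forall>x t. ((\<lambda>y. f (y, t)) has_vector_derivative g (x, t)) (at x)) \<and>
     (\<exists>g\<in>gauss_poly. \<forall>x t. ((\<lambda>y. f (x, y)) has_vector_derivative g (x, t)) (at t))"
  using assms
proof induction
  case (monom a d C m n A B)
  \<comment> \<open>For m = 0 the truncated exponent \<open>m - 1\<close> is harmless, as its
    coefficient \<open>of_nat m\<close> is 0.\<close>
  have P: "((\<lambda>y. C * of_real (y ^ m) * gauss a A y) has_vector_derivative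
     (C * of_nat m) * of_real (x ^ (m - 1)) * gauss a A x +
       ((- C * of_real a) * of_real (x ^ Suc m) * gauss a A x + (C * \<i> * of_real A) * of_real (x ^ m) * gauss a A x)) (at x)"
    for x m a A C
  proof -
      show ?thesis
      using has_vector_derivative_mult[OF has_vector_derivative_mult[OF has_vector_derivative_const[of C] of_real_power_has_vector_derivative[of m x]]
          gauss_has_vector_derivative[of a A x UNIV]]
      by (simp add: algebra_simps)
  qed
  have X: "((\<lambda>y. C * of_real (y ^ m) * of_real (t ^ n) * packet a d A B (y, t)) has_vector_derivative
     (C * of_nat m) * of_real (x ^ (m - 1)) * of_real (t ^ n) * packet a d A B (x, t) +
       ((- C * of_real a) * of_real (x ^ Suc m) * of_real (t ^ n) * packet a d A B (x, t) +
        (C * \<i> * of_real A) * of_real (x ^ m) * of_real (t ^ n) * packet a d A B (x, t))) (at x)" for x t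
    using has_vector_derivative_mult_left[OF P[of C m a A x], of "of_real (t ^ n) * gauss d B t"]
    by (simp add: packet_def algebra_simps)
  have T: "((\<lambda>y. C * of_real (x ^ m) * of_real (y ^ n) * packet a d A B (x, y)) has_vector_derivative
     (C * of_nat n) * of_real (x ^ m) * of_real (t ^ (n - 1)) * packet a d A B (x, t) +
       ((- C * of_real d) * of_real (x ^ m) * of_real (t ^ Suc n) * packet a d A B (x, t) +
        (C * \<i> * of_real B) * of_real (x ^ m) * of_real (t ^ n) * packet a d A B (x, t))) (at t)" for x t
    using has_vector_derivative_mult_left[OF P[of C n d B t], of "of_real (x ^ m) * gauss a A x"]
    by (simp add: packet_def algebra_simps)
  let ?u = "\<lambda>C m n p. C * of_real (fst p ^ m) * of_real (snd p ^ n) * packet a d A B p"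
  show ?case
  proof
    show "\<exists>g\<in>gauss_poly. \<forall>x t. ((\<lambda>y. ?u C m n (y, t)) has_vector_derivative g (x, t)) (at x)"
      by (rule bexI[of _ "\<lambda>p. ?u (C * of_nat m) (m - 1) n p +
            (?u (- C * of_real a) (Suc m) n p + ?u (C * \<i> * of_real A) m n p)"])
        (use X in simp, intro gauss_poly.add gauss_poly.monom monom)
    show "\<exists>g\<in>gauss_poly. \<forall>x t. ((\<lambda>y. ?u C m n (x, y)) has_vector_derivative g (x, t)) (at t)"
      by (rule bexI[of _ "\<lambda>p. ?u (C * of_nat n) m (n - 1) p +
            (?u (- C * of_real d) m (Suc n) p + ?u (C * \<i> * of_real B) m n p)"])
        (use T in simp, intro gauss_poly.add gauss_poly.monom monom)
  qed
next
  case (add f g)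
  then obtain f1 f2 g1 g2 where
    "f1 \<in> gauss_poly" "\<And>x t. ((\<lambda>y. f (y, t)) has_vector_derivative f1 (x, t)) (at x)"
    "f2 \<in> gauss_poly" "\<And>x t. ((\<lambda>y. f (x, y)) has_vector_derivative f2 (x, t)) (at t)"
    "g1 \<in> gauss_poly" "\<And>x t. ((\<lambda>y. g (y, t)) has_vector_derivative g1 (x, t)) (at x)"
    "g2 \<in> gauss_poly" "\<And>x t. ((\<lambda>y. g (x, y)) has_vector_derivative g2 (x, t)) (at t)"
    by blast
  then show ?case
    by (intro conjI bexI[of _ "\<lambda>p. f1 p + g1 p"] bexI[of _ "\<lambda>p. f2 p + g2 p"])
      (auto intro: has_vector_derivative_add gauss_poly.add)
qed

lemma gauss_poly_partial_x: "f \<in> gauss_poly \<Longrightarrow> partial_x f \<in> gauss_poly"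
  using gauss_poly_partials partial_x_eqI by metis

lemma gauss_poly_partial_t: "f \<in> gauss_poly \<Longrightarrow> partial_t f \<in> gauss_poly"
  using gauss_poly_partials partial_t_eqI by metis

lemma schwartz_gauss_poly:
  assumes "f \<in> gauss_poly"
  shows "schwartz f"
proof -
  have t: "(partial_t ^^ k) f \<in> gauss_poly" for k
    using assms by (induction k) (auto intro: gauss_poly_partial_t)
  have it: "iterated_partial j k f \<in> gauss_poly" for j k
    unfolding iterated_partial_def by (induction j) (auto intro: gauss_poly_partial_x t)
  show ?thesis
    unfolding schwartz_def smooth2_def
    using gauss_poly_differentiable[OF it] gauss_poly_bounded[OF gauss_poly_mult_monom[OF it]]
    by simp
qed

subsection \<open>Packets in the weighted norms\<close>

lemma jbracket_ge_1: "jbracket x \<ge> 1"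
  by (simp add: jbracket_def)

text \<open>The slope of the cube near A is of order N^2, so a deviation of order N^-2 in \<xi>
  moves \<xi>^3 by O(1) only. This dictates the width of the packets.\<close>

lemma abs_cube_diff_le:
  fixes A N \<xi> :: real
  assumes N: "N \<ge> 1" and A: "\<bar>A\<bar> \<le> 3 * N"
  shows "\<bar>\<xi> ^ 3 - A ^ 3\<bar> \<le> 27 * (1 + \<bar>N\<^sup>2 * (\<xi> - A)\<bar>) ^ 3"
proof -
  define x where "x = \<xi> - A"
  define y where "y = N\<^sup>2 * \<bar>x\<bar>"
  have "1 * \<bar>x\<bar> \<le> N\<^sup>2 * \<bar>x\<bar>" "N * \<bar>x\<bar> \<le> N\<^sup>2 * \<bar>x\<bar>"
    using mult_right_mono[OF one_le_power[OF N, of 2], of "\<bar>x\<bar>"] N self_le_power[of N 2]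
    by (auto intro!: mult_right_mono)
  then have xy: "\<bar>x\<bar> \<le> y" "N * \<bar>x\<bar> \<le> y" "0 \<le> y"
    by (auto simp: y_def)
  \<comment> \<open>Taylor expansion of the cube about A. With y = N^2 |x| the three terms are at
    most 27 y, 9 y^2 and y^3.\<close>
  have "\<xi> ^ 3 - A ^ 3 = 3 * (A\<^sup>2 * x) + 3 * (A * x * x) + x ^ 3"
    by (simp add: x_def power2_eq_square power3_eq_cube algebra_simps)
  then have "\<bar>\<xi> ^ 3 - A ^ 3\<bar> \<le> 3 * (A\<^sup>2 * \<bar>x\<bar>) + 3 * (\<bar>A\<bar> * \<bar>x\<bar> * \<bar>x\<bar>) + \<bar>x\<bar> ^ 3"
    using abs_triangle_ineq[of "3 * (A\<^sup>2 * x) + 3 * (A * x * x)" "x ^ 3"]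
      abs_triangle_ineq[of "3 * (A\<^sup>2 * x)" "3 * (A * x * x)"]
    by (simp add: abs_mult power_abs)
  also have "A\<^sup>2 * \<bar>x\<bar> \<le> 9 * y"
  proof -
    have "A\<^sup>2 \<le> (3 * N)\<^sup>2" using A by (metis abs_ge_zero power2_abs power_mono)
    then have "A\<^sup>2 * \<bar>x\<bar> \<le> (3 * N)\<^sup>2 * \<bar>x\<bar>" by (rule mult_right_mono) simp
    then show ?thesis by (simp add: y_def power_mult_distrib)
  qed
  also have "\<bar>A\<bar> * \<bar>x\<bar> * \<bar>x\<bar> \<le> 3 * y * y"
  proof -
    have "\<bar>A\<bar> * \<bar>x\<bar> \<le> 3 * N * \<bar>x\<bar>" using A by (rule mult_right_mono) simp
    also have "\<dots> \<le> 3 * y" using xy by simp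
    finally have "\<bar>A\<bar> * \<bar>x\<bar> \<le> 3 * y" .
    from mult_mono[OF this xy(1)] show ?thesis using xy by simp
  qed
  also have "\<bar>x\<bar> ^ 3 \<le> y ^ 3" using xy by (intro power_mono) auto
  also have "3 * (9 * y) + 3 * (3 * y * y) + y ^ 3 \<le> 27 * (1 + y) ^ 3"
    using xy(3) by (simp add: power3_eq_cube algebra_simps)
  also have "y = \<bar>N\<^sup>2 * (\<xi> - A)\<bar>" by (simp add: y_def x_def abs_mult)
  finally show ?thesis by simp
qed

text \<open>Passing to a natural exponent above |b| treats both signs of b at once. The upper bound
  serves the weights in the norm estimates, the lower one the dispersive weight of the
  output.\<close>

lemma powr_le_power:
  fixes z y b :: real
  assumes "1 \<le> z" "z \<le> y" "\<bar>b\<bar> \<le> real M"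
  shows "z powr b \<le> y ^ M" "z powr b \<ge> 1 / y ^ M"
proof -
  have "z powr b \<le> z powr real M" using assms by (intro powr_mono) auto
  also have "\<dots> = z ^ M" using assms by (simp add: powr_realpow)
  also have "\<dots> \<le> y ^ M" using assms by (intro power_mono) auto
  finally show "z powr b \<le> y ^ M" .
  have "1 / y ^ M \<le> 1 / z ^ M" using assms by (intro divide_left_mono power_mono mult_pos_pos) auto
  also have "\<dots> = z powr (- real M)" using assms by (simp add: powr_minus_divide powr_realpow)
  also have "\<dots> \<le> z powr b" using assms by (intro powr_mono) auto
  finally show "z powr b \<ge> 1 / y ^ M" .
qed

text \<open>The quantity \<tau> - \<beta> \<xi>^3 splits into the offset \<tau> - B, the distance of
  the centre from the curve, and \<beta> times the cubic deviation. The bound is a product so that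
  its powers separate into a factor in \<xi> and one in \<tau>.\<close>

lemma jbracket_le:
  fixes A B N \<xi> \<tau> \<beta> D :: real
  assumes N: "N \<ge> 1" and A: "\<bar>A\<bar> \<le> 3 * N" and D: "\<bar>B - \<beta> * A ^ 3\<bar> \<le> D"
  shows "jbracket (\<tau> - \<beta> * \<xi> ^ 3) \<le> (1 + D + 27 * \<bar>\<beta>\<bar>) * (1 + \<bar>\<tau> - B\<bar>) * (1 + \<bar>N\<^sup>2 * (\<xi> - A)\<bar>) ^ 3"
proof -
  define z where "z = (1 + \<bar>N\<^sup>2 * (\<xi> - A)\<bar>) ^ 3"
  have z: "z \<ge> 1" unfolding z_def by (intro one_le_power) simp
  have D0: "D \<ge> 0" using D by linarith
  have "\<tau> - \<beta> * \<xi> ^ 3 = (\<tau> - B) + (B - \<beta> * A ^ 3) - \<beta> * (\<xi> ^ 3 - A ^ 3)" by (simp add: algebra_simps)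
  then have "\<bar>\<tau> - \<beta> * \<xi> ^ 3\<bar> \<le> \<bar>\<tau> - B\<bar> + D + \<bar>\<beta>\<bar> * \<bar>\<xi> ^ 3 - A ^ 3\<bar>"
    using D unfolding abs_mult[symmetric] by linarith
  also have "\<bar>\<beta>\<bar> * \<bar>\<xi> ^ 3 - A ^ 3\<bar> \<le> \<bar>\<beta>\<bar> * (27 * z)"
    unfolding z_def by (intro mult_left_mono abs_cube_diff_le N A) auto
  finally have "jbracket (\<tau> - \<beta> * \<xi> ^ 3) \<le> (1 + \<bar>\<tau> - B\<bar>) + D + 27 * \<bar>\<beta>\<bar> * z"
    by (simp add: jbracket_def)
  also have "\<dots> \<le> (1 + \<bar>\<tau> - B\<bar>) * z + D * ((1 + \<bar>\<tau> - B\<bar>) * z) + 27 * \<bar>\<beta>\<bar> * ((1 + \<bar>\<tau> - B\<bar>) * z)"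
  proof (intro add_mono)
    have t: "(1 + \<bar>\<tau> - B\<bar>) \<ge> 1" by simp
    show "1 + \<bar>\<tau> - B\<bar> \<le> (1 + \<bar>\<tau> - B\<bar>) * z" using mult_left_mono[OF z, of "1 + \<bar>\<tau> - B\<bar>"] by simp
    show "D \<le> D * ((1 + \<bar>\<tau> - B\<bar>) * z)"
      using mult_left_mono[OF mult_mono[OF t z], of D] D0 by simp
    show "27 * \<bar>\<beta>\<bar> * z \<le> 27 * \<bar>\<beta>\<bar> * ((1 + \<bar>\<tau> - B\<bar>) * z)"
      using mult_right_mono[OF t, of z] z by (intro mult_left_mono) auto
  qed
  also have "\<dots> = (1 + D + 27 * \<bar>\<beta>\<bar>) * (1 + \<bar>\<tau> - B\<bar>) * z" by (simp add: algebra_simps)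
  finally show ?thesis by (simp add: z_def)
qed

definition X_weight :: "real \<Rightarrow> real \<Rightarrow> real \<Rightarrow> real \<times> real \<Rightarrow> real" where
  "X_weight \<beta> s b = (\<lambda>(\<xi>, \<tau>). jbracket (\<tau> - \<beta> * \<xi> ^ 3) powr b * jbracket \<xi> powr s)"

lemma X_weight_nonneg: "X_weight \<beta> s b q \<ge> 0"
  by (simp add: X_weight_def case_prod_unfold)

lemma X_norm_eq:
  "X_norm c \<beta> s b f = sqrt (LINT q|lborel. (X_weight \<beta> s b q * norm (fourier2 c f q))\<^sup>2)"
  by (simp add: X_norm_def X_weight_def case_prod_unfold norm_mult del: power_mult_distrib)

lemma borel_measurable_fst_snd [measurable]:
  "fst \<in> borel_measurable (borel :: (real \<times> real) measure)"
  "snd \<in> borel_measurable (borel :: (real \<times> real) measure)"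
  by (intro borel_measurable_continuous_onI continuous_intros)+

lemma borel_measurable_X_weight [measurable]: "X_weight \<beta> s b \<in> borel_measurable borel"
  unfolding X_weight_def jbracket_def case_prod_unfold by measurable

lemma borel_measurable_packet_hat [measurable]: "packet_hat a d A B \<in> borel_measurable borel"
  unfolding packet_hat_def case_prod_unfold by measurable

lemma packet_hat_nonneg: "a > 0 \<Longrightarrow> d > 0 \<Longrightarrow> packet_hat a d A B q \<ge> 0"
  by (simp add: packet_hat_def case_prod_unfold)

text \<open>The range of k covers the input packets (k = 1) and the threefold products (k = 3); the
  rate 1/6 is the slowest decay, reached at k = 3. The height N^2 comes from the normalisation in
  \<xi>.\<close>

lemma packet_hat_le:
  fixes k N :: real
  assumes N: "N \<ge> 1" and k: "1 \<le> k" "k \<le> 3"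
  shows "packet_hat (k / N ^ 4) k A B (\<xi>, \<tau>) \<le>
    2 * pi * N\<^sup>2 * (exp (- (N\<^sup>2 * (\<xi> - A))\<^sup>2 / 6) * exp (- (\<tau> - B)\<^sup>2 / 6))"
proof -
  have e: "exp (- x\<^sup>2 / (2 * k)) \<le> exp (- x\<^sup>2 / 6)" for x :: real
  proof -
    have "x\<^sup>2 / 6 \<le> x\<^sup>2 / (2 * k)" using k by (intro divide_left_mono) auto
    then show ?thesis by simp
  qed
  have "sqrt (2 * pi / k) \<le> sqrt (2 * pi)"
    using k by (intro real_sqrt_le_mono) (simp add: field_simps)
  moreover have "sqrt (2 * pi / (k / N ^ 4)) = N\<^sup>2 * sqrt (2 * pi / k)"
  proof -
    have "2 * pi / (k / N ^ 4) = (N\<^sup>2)\<^sup>2 * (2 * pi / k)" by simp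
    then show ?thesis by (simp only: real_sqrt_mult real_sqrt_abs) simp
  qed
  ultimately have 1: "sqrt (2 * pi / (k / N ^ 4)) \<le> N\<^sup>2 * sqrt (2 * pi)" and 2: "sqrt (2 * pi / k) \<le> sqrt (2 * pi)"
    by (auto intro: mult_left_mono)
  have 3: "- (\<xi> - A)\<^sup>2 / (2 * (k / N ^ 4)) = - (N\<^sup>2 * (\<xi> - A))\<^sup>2 / (2 * k)"
  proof -
    have "(N\<^sup>2 * (\<xi> - A))\<^sup>2 = N ^ 4 * (\<xi> - A)\<^sup>2" by (simp add: power_mult_distrib)
    then show ?thesis by simp
  qed
  have "packet_hat (k / N ^ 4) k A B (\<xi>, \<tau>) \<le>
     (N\<^sup>2 * sqrt (2 * pi) * exp (- (N\<^sup>2 * (\<xi> - A))\<^sup>2 / 6)) * (sqrt (2 * pi) * exp (- (\<tau> - B)\<^sup>2 / 6))"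
    unfolding packet_hat_def case_prod_conv 3
    by (intro mult_mono 1 2 e) (use k in auto)
  also have "\<dots> = (sqrt (2 * pi) * sqrt (2 * pi)) * N\<^sup>2 * (exp (- (N\<^sup>2 * (\<xi> - A))\<^sup>2 / 6) * exp (- (\<tau> - B)\<^sup>2 / 6))"
    by (simp only: mult_ac)
  finally show ?thesis by simp
qed

text \<open>In the rescaled offsets x and y this is the square of exp(-x^2/12) exp(-y^2/12), the
  half of the decay in \<open>packet_hat_le\<close> that survives once the other half has absorbed
  the weights. Its mass, of order N^-2, turns pointwise bounds of order N^(s+2) into norms of order
  N^(s+1).\<close>

definition majorant :: "real \<Rightarrow> real \<Rightarrow> real \<Rightarrow> real \<times> real \<Rightarrow> real" where
  "majorant N A B = (\<lambda>p. exp (- (N ^ 4 / 3 * (fst p - A)\<^sup>2) / 2) * exp (- (1 / 3 * (snd p - B)\<^sup>2) / 2))"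

lemma
  assumes "N \<ge> 1"
  shows integrable_majorant: "integrable lborel (majorant N A B)"
    and integral_majorant: "(LINT p|lborel. majorant N A B p) = 6 * pi / N\<^sup>2"
proof -
  have 1: "has_bochner_integral lborel (\<lambda>x. exp (- (N ^ 4 / 3 * (x - A)\<^sup>2) / 2)) (sqrt (2 * pi / (N ^ 4 / 3)))"
    using assms by (intro has_bochner_integral_gaussian) auto
  have 2: "has_bochner_integral lborel (\<lambda>x. exp (- (1 / 3 * (x - B)\<^sup>2) / 2)) (sqrt (2 * pi / (1 / 3)))"
    by (intro has_bochner_integral_gaussian) auto
  note i = has_bochner_integral_iff[THEN iffD1, THEN conjunct1, OF 1]
    has_bochner_integral_iff[THEN iffD1, THEN conjunct1, OF 2]
  show "integrable lborel (majorant N A B)"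
    unfolding majorant_def using i by (rule integrable_lborel_times)
  have "(LINT p|lborel. majorant N A B p) = sqrt (2 * pi / (N ^ 4 / 3)) * sqrt (2 * pi / (1 / 3))"
    unfolding majorant_def integral_lborel_times[OF i]
    using 1 2 by (simp add: has_bochner_integral_iff)
  also have "\<dots> = sqrt ((6 * pi / N\<^sup>2)\<^sup>2)"
    unfolding real_sqrt_mult[symmetric] by (simp add: power_divide field_simps flip: power2_eq_square)
  also have "\<dots> = 6 * pi / N\<^sup>2" by simp
  finally show "(LINT p|lborel. majorant N A B p) = 6 * pi / N\<^sup>2" .
qed

text \<open>The bound \<open>D\<close> leaves room for packets off the curve, which occur in the product; on the curve
  \<open>D = 0\<close>, and it matters that \<open>K\<close> does not depend on \<open>N\<close>.\<close>

lemma packet_weight_bound: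
  fixes \<beta> s b D :: real
  assumes s: "s \<le> 0"
  obtains K where "K > 0"
    "\<And>N A B k q. 1 \<le> N \<Longrightarrow> N \<le> \<bar>A\<bar> \<Longrightarrow> \<bar>A\<bar> \<le> 3 * N \<Longrightarrow> \<bar>B - \<beta> * A ^ 3\<bar> \<le> D \<Longrightarrow> 1 \<le> k \<Longrightarrow> k \<le> 3 \<Longrightarrow>
      (X_weight \<beta> s b q * ((1 + \<bar>N\<^sup>2 * (fst q - A)\<bar>) * packet_hat (k / N ^ 4) k A B q))\<^sup>2
        \<le> (K * N powr (s + 2))\<^sup>2 * majorant N A B q"
proof -
  obtain M :: nat where M: "\<bar>b\<bar> \<le> real M" by (meson real_arch_simple)
  obtain L :: nat where L: "\<bar>s\<bar> \<le> real L" by (meson real_arch_simple)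
  \<comment> \<open>The exponent collects \<open>3 * M\<close> from the cubed factor in
    \<open>jbracket_le\<close>, \<open>L\<close> from the weight in \<xi>, and 1 from the extra
    factor in the claim, which will later control the derivative. The rate 1/12 is half of the
    available 1/6.\<close>
  obtain K1 where K1: "K1 > 0" "\<And>x::real. (1 + \<bar>x\<bar>) ^ (3 * M + L + 1) \<le> K1 * exp (1 / 12 * x\<^sup>2)"
    by (rule power_le_exp_square[of "1 / 12" "3 * M + L + 1"]) auto
  obtain K2 where K2: "K2 > 0" "\<And>x::real. (1 + \<bar>x\<bar>) ^ M \<le> K2 * exp (1 / 12 * x\<^sup>2)"
    by (rule power_le_exp_square[of "1 / 12" M]) auto
  define E where "E = (1 + \<bar>D\<bar> + 27 * \<bar>\<beta>\<bar>) ^ M"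
  have E: "E > 0" by (auto simp: E_def intro!: zero_less_power add_pos_nonneg)
  define K where "K = E * K1 * K2 * (2 * pi)"
  show thesis
  proof
    show "K > 0" using E K1 K2 by (simp add: K_def)
    fix N A B k :: real and q :: "real \<times> real"
    assume N: "1 \<le> N" and A: "N \<le> \<bar>A\<bar>" "\<bar>A\<bar> \<le> 3 * N" and D: "\<bar>B - \<beta> * A ^ 3\<bar> \<le> D" and k: "1 \<le> k" "k \<le> 3"
    obtain \<xi> \<tau> where q: "q = (\<xi>, \<tau>)" by force
    define x where "x = N\<^sup>2 * (\<xi> - A)"
    define y where "y = \<tau> - B"
    have w1: "jbracket (\<tau> - \<beta> * \<xi> ^ 3) powr b \<le> E * (1 + \<bar>y\<bar>) ^ M * (1 + \<bar>x\<bar>) ^ (3 * M)"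
    proof -
      have "jbracket (\<tau> - \<beta> * \<xi> ^ 3) \<le> (1 + \<bar>D\<bar> + 27 * \<bar>\<beta>\<bar>) * (1 + \<bar>y\<bar>) * (1 + \<bar>x\<bar>) ^ 3"
        unfolding x_def y_def using D by (intro jbracket_le N A) auto
      from powr_le_power(1)[OF jbracket_ge_1 this M] show ?thesis
        by (simp add: E_def power_mult_distrib power_mult)
    qed
    \<comment> \<open>As s is nonpositive, this weight is largest near \<xi> = 0, where the packet
      is far in its tail: N is at most \<open>jbracket \<xi> * (1 + \<bar>x\<bar>)\<close>, so the
      loss is polynomial in x.\<close>
    have w2: "jbracket \<xi> powr s \<le> N powr s * (1 + \<bar>x\<bar>) ^ L"
    proof -
      have "\<bar>\<xi> - A\<bar> \<le> \<bar>x\<bar>"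
        using N mult_right_mono[of 1 "N\<^sup>2" "\<bar>\<xi> - A\<bar>"] by (simp add: x_def abs_mult)
      then have "N \<le> \<bar>\<xi>\<bar> + \<bar>x\<bar>" using A by linarith
      also have "\<dots> \<le> jbracket \<xi> * (1 + \<bar>x\<bar>)" by (simp add: jbracket_def algebra_simps)
      finally have "N / (1 + \<bar>x\<bar>) \<le> jbracket \<xi>" by (simp add: field_simps)
      then have "jbracket \<xi> powr s \<le> (N / (1 + \<bar>x\<bar>)) powr s"
        using N s by (intro powr_mono2') auto
      also have "\<dots> = N powr s * (1 + \<bar>x\<bar>) powr (- s)"
        using N by (simp add: powr_divide powr_minus_divide)
      also have "\<dots> \<le> N powr s * (1 + \<bar>x\<bar>) ^ L"
        using L by (intro mult_left_mono powr_le_power) auto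
      finally show ?thesis .
    qed
    have "X_weight \<beta> s b q * ((1 + \<bar>x\<bar>) * packet_hat (k / N ^ 4) k A B q)
       \<le> (E * (1 + \<bar>y\<bar>) ^ M * (1 + \<bar>x\<bar>) ^ (3 * M)) * (N powr s * (1 + \<bar>x\<bar>) ^ L) *
         ((1 + \<bar>x\<bar>) * (2 * pi * N\<^sup>2 * (exp (- x\<^sup>2 / 6) * exp (- y\<^sup>2 / 6))))"
      unfolding X_weight_def q case_prod_conv x_def y_def
      using E N k
      by (intro mult_mono mult_left_mono w1[unfolded x_def y_def] w2[unfolded x_def] packet_hat_le
          mult_nonneg_nonneg packet_hat_nonneg) auto
    also have "\<dots> = E * (2 * pi) * (N powr s * N\<^sup>2) *
        (((1 + \<bar>x\<bar>) ^ (3 * M + L + 1) * exp (- x\<^sup>2 / 6)) * ((1 + \<bar>y\<bar>) ^ M * exp (- y\<^sup>2 / 6)))"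
      by (simp add: power_add mult_ac)
    also have "\<dots> \<le> E * (2 * pi) * (N powr s * N\<^sup>2) *
        (((K1 * exp (1 / 12 * x\<^sup>2)) * exp (- x\<^sup>2 / 6)) * ((K2 * exp (1 / 12 * y\<^sup>2)) * exp (- y\<^sup>2 / 6)))"
      using E N K1 K2 by (intro mult_left_mono mult_mono mult_right_mono) auto
    also have "\<dots> = K * N powr (s + 2) * ((exp (1 / 12 * x\<^sup>2) * exp (- x\<^sup>2 / 6)) * (exp (1 / 12 * y\<^sup>2) * exp (- y\<^sup>2 / 6)))"
      using N by (simp add: K_def powr_add mult_ac)
    also have "\<dots> = K * N powr (s + 2) * (exp (- x\<^sup>2 / 12) * exp (- y\<^sup>2 / 12))"
      unfolding exp_add[symmetric] by (simp add: field_simps)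
    finally have "(X_weight \<beta> s b q * ((1 + \<bar>x\<bar>) * packet_hat (k / N ^ 4) k A B q))\<^sup>2
        \<le> (K * N powr (s + 2) * (exp (- x\<^sup>2 / 12) * exp (- y\<^sup>2 / 12)))\<^sup>2"
      using k N by (intro power_mono mult_nonneg_nonneg X_weight_nonneg packet_hat_nonneg) auto
    also have "\<dots> = (K * N powr (s + 2))\<^sup>2 * majorant N A B q"
    proof -
      have "x\<^sup>2 = N ^ 4 * (\<xi> - A)\<^sup>2" by (simp add: x_def power_mult_distrib)
      then show ?thesis
        by (simp add: majorant_def y_def q power_mult_distrib flip: exp_double)
    qed
    finally show "(X_weight \<beta> s b q * ((1 + \<bar>N\<^sup>2 * (fst q - A)\<bar>) * packet_hat (k / N ^ 4) k A B q))\<^sup>2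
        \<le> (K * N powr (s + 2))\<^sup>2 * majorant N A B q" by (simp add: q x_def)
  qed
qed

text \<open>Only the majorant has to be integrable: if the left integrand were not, its integral
  would be the default 0 and the bound would still hold.\<close>

lemma X_norm_le:
  assumes "integrable lborel G" "\<And>q. (X_weight \<beta> s b q * norm (fourier2 c f q))\<^sup>2 \<le> G q"
  shows "X_norm c \<beta> s b f \<le> sqrt (LINT q|lborel. G q)"
  unfolding X_norm_eq
  by (intro real_sqrt_le_mono integral_mono' assms order_trans[OF zero_le_power2 assms(2)])

text \<open>The pointwise size N^(s+2) is multiplied by the square root of the mass of
  \<open>majorant\<close>, of order 1/N. The reflected packet obeys the same bound because the cube
  is odd, which puts its centre on the same curve.\<close>

lemma X_norm_packet_le:
  fixes \<beta> s b :: real and c :: complex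
  assumes s: "s \<le> 0"
  obtains K where "K \<ge> 0"
    "\<And>N. 1 \<le> N \<Longrightarrow> X_norm c \<beta> s b (packet (1 / N ^ 4) 1 N (\<beta> * N ^ 3)) \<le> K * N powr (s + 1)"
    "\<And>N. 1 \<le> N \<Longrightarrow> X_norm c \<beta> s b (\<lambda>p. packet (1 / N ^ 4) 1 N (\<beta> * N ^ 3) p +
        packet (1 / N ^ 4) 1 (- N) (- (\<beta> * N ^ 3)) p) \<le> K * N powr (s + 1)"
proof -
  obtain K where K: "K > 0"
    "\<And>N A B k q. 1 \<le> N \<Longrightarrow> N \<le> \<bar>A\<bar> \<Longrightarrow> \<bar>A\<bar> \<le> 3 * N \<Longrightarrow> \<bar>B - \<beta> * A ^ 3\<bar> \<le> 0 \<Longrightarrow> 1 \<le> k \<Longrightarrow> k \<le> 3 \<Longrightarrow>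
      (X_weight \<beta> s b q * ((1 + \<bar>N\<^sup>2 * (fst q - A)\<bar>) * packet_hat (k / N ^ 4) k A B q))\<^sup>2
        \<le> (K * N powr (s + 2))\<^sup>2 * majorant N A B q"
    using packet_weight_bound[OF s, of \<beta> 0 b] by metis
  have pw: "(X_weight \<beta> s b q * norm (fourier2 c (packet (1 / N ^ 4) 1 A B) q))\<^sup>2
      \<le> (norm c * K * N powr (s + 2))\<^sup>2 * majorant N A B q"
    if N: "1 \<le> N" and A: "N \<le> \<bar>A\<bar>" "\<bar>A\<bar> \<le> 3 * N" "\<bar>B - \<beta> * A ^ 3\<bar> \<le> 0" for N A B q
  proof -
    let ?H = "packet_hat (1 / N ^ 4) 1 A B q"
    have H: "?H \<ge> 0" using N by (intro packet_hat_nonneg) auto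
    have "X_weight \<beta> s b q * norm (fourier2 c (packet (1 / N ^ 4) 1 A B) q) =
        norm c * (X_weight \<beta> s b q * (1 * ?H))"
      using N H by (subst fourier2_packet) (auto simp: norm_mult)
    also have "\<dots> \<le> norm c * (X_weight \<beta> s b q * ((1 + \<bar>N\<^sup>2 * (fst q - A)\<bar>) * ?H))"
      using H by (intro mult_left_mono mult_right_mono X_weight_nonneg) auto
    finally have "(X_weight \<beta> s b q * norm (fourier2 c (packet (1 / N ^ 4) 1 A B) q))\<^sup>2 \<le>
        (norm c * (X_weight \<beta> s b q * ((1 + \<bar>N\<^sup>2 * (fst q - A)\<bar>) * ?H)))\<^sup>2"
      by (intro power_mono mult_nonneg_nonneg X_weight_nonneg) auto
    also have "\<dots> \<le> (norm c)\<^sup>2 * ((K * N powr (s + 2))\<^sup>2 * majorant N A B q)"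
      unfolding power_mult_distrib[of "norm c"] using K(2)[OF N A, of 1 q]
      by (intro mult_left_mono) auto
    also have "\<dots> = (norm c * K * N powr (s + 2))\<^sup>2 * majorant N A B q"
      by (simp add: power_mult_distrib)
    finally show ?thesis .
  qed
  \<comment> \<open>Used with r = 1 for one packet and r = 2 for the sum, where (x + y)^2 \<le> 2
    x^2 + 2 y^2 and the equal masses of the two majorants give the factor 4.\<close>
  have val: "sqrt (r\<^sup>2 * ((norm c * K * N powr (s + 2))\<^sup>2 * (6 * pi / N\<^sup>2)))
      = (r * norm c * K * sqrt (6 * pi)) * N powr (s + 1)" if "1 \<le> N" "r \<ge> 0" for N r
  proof -
    have "N powr (s + 2) = N powr (s + 1) * N"
      using powr_add[of N "s + 1" 1] that by (simp add: add.assoc)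
    then have "r\<^sup>2 * ((norm c * K * N powr (s + 2))\<^sup>2 * (6 * pi / N\<^sup>2)) =
        ((r * norm c * K) * N powr (s + 1))\<^sup>2 * (6 * pi)"
      using that by (simp add: power_mult_distrib)
    then show ?thesis
      using that K(1) by (simp only: real_sqrt_mult real_sqrt_abs) (simp add: abs_mult)
  qed
  show thesis
  proof (rule that[of "2 * norm c * K * sqrt (6 * pi)"])
    show "2 * norm c * K * sqrt (6 * pi) \<ge> 0" using K by simp
    fix N :: real assume N: "1 \<le> N"
    let ?C = "(norm c * K * N powr (s + 2))\<^sup>2"
    let ?m1 = "majorant N N (\<beta> * N ^ 3)" and ?m2 = "majorant N (- N) (- (\<beta> * N ^ 3))"
    let ?p1 = "packet (1 / N ^ 4) 1 N (\<beta> * N ^ 3)" and ?p2 = "packet (1 / N ^ 4) 1 (- N) (- (\<beta> * N ^ 3))"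
    note int = integrable_majorant[OF N]
    have pw1: "(X_weight \<beta> s b q * norm (fourier2 c ?p1 q))\<^sup>2 \<le> ?C * ?m1 q" for q
      using N by (intro pw) auto
    have pw2: "(X_weight \<beta> s b q * norm (fourier2 c ?p2 q))\<^sup>2 \<le> ?C * ?m2 q" for q
      using N by (intro pw) auto
    have "X_norm c \<beta> s b ?p1 \<le> sqrt (LINT q|lborel. ?C * ?m1 q)"
      by (intro X_norm_le integrable_mult_right int pw1)
    also have "\<dots> = (1 * norm c * K * sqrt (6 * pi)) * N powr (s + 1)"
      using val[OF N, of 1] by (simp add: integral_majorant[OF N])
    also have "\<dots> \<le> (2 * norm c * K * sqrt (6 * pi)) * N powr (s + 1)"
      using K by (intro mult_right_mono) auto
    finally show "X_norm c \<beta> s b ?p1 \<le> (2 * norm c * K * sqrt (6 * pi)) * N powr (s + 1)" .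
    have "X_norm c \<beta> s b (\<lambda>p. ?p1 p + ?p2 p) \<le> sqrt (LINT q|lborel. 2 * (?C * ?m1 q) + 2 * (?C * ?m2 q))"
    proof (intro X_norm_le integrable_mult_right int Bochner_Integration.integrable_add)
      fix q
      let ?E = "X_weight \<beta> s b q"
      have "?E * norm (fourier2 c (\<lambda>p. ?p1 p + ?p2 p) q) \<le> ?E * norm (fourier2 c ?p1 q) + ?E * norm (fourier2 c ?p2 q)"
        using N unfolding distrib_left[symmetric]
        by (subst fourier2_add) (auto intro!: integrable_packet mult_left_mono X_weight_nonneg norm_triangle_ineq)
      then have "(?E * norm (fourier2 c (\<lambda>p. ?p1 p + ?p2 p) q))\<^sup>2 \<le> (?E * norm (fourier2 c ?p1 q) + ?E * norm (fourier2 c ?p2 q))\<^sup>2"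
        by (intro power_mono mult_nonneg_nonneg X_weight_nonneg) auto
      also have "\<dots> \<le> 2 * (?E * norm (fourier2 c ?p1 q))\<^sup>2 + 2 * (?E * norm (fourier2 c ?p2 q))\<^sup>2"
      proof -
        have "(x + y)\<^sup>2 \<le> 2 * x\<^sup>2 + 2 * y\<^sup>2" for x y :: real
          using zero_le_power2[of "x - y"] by (simp add: power2_eq_square algebra_simps)
        then show ?thesis .
      qed
      also have "\<dots> \<le> 2 * (?C * ?m1 q) + 2 * (?C * ?m2 q)"
        using pw1[of q] pw2[of q] by linarith
      finally show "(?E * norm (fourier2 c (\<lambda>p. ?p1 p + ?p2 p) q))\<^sup>2 \<le> 2 * (?C * ?m1 q) + 2 * (?C * ?m2 q)" .
    qed
    also have "(LINT q|lborel. 2 * (?C * ?m1 q) + 2 * (?C * ?m2 q)) = 2\<^sup>2 * (?C * (6 * pi / N\<^sup>2))"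
      by (subst Bochner_Integration.integral_add)
        (auto intro!: int simp: integral_majorant[OF N] simp del: power_mult_distrib)
    also have "sqrt \<dots> = (2 * norm c * K * sqrt (6 * pi)) * N powr (s + 1)"
      using N by (rule val) simp
    finally show "X_norm c \<beta> s b (\<lambda>p. ?p1 p + ?p2 p) \<le> (2 * norm c * K * sqrt (6 * pi)) * N powr (s + 1)" .
  qed
qed

section \<open>The trilinear output: expansion into packets, Fourier transform and lower
  bound\<close>

lemma partial_x_output:
  fixes N \<beta> \<gamma> :: real
  defines "v \<equiv> packet (1 / N ^ 4) 1 N (\<beta> * N ^ 3)"
    and "w \<equiv> \<lambda>p. packet (1 / N ^ 4) 1 N (\<gamma> * N ^ 3) p + packet (1 / N ^ 4) 1 (- N) (- (\<gamma> * N ^ 3)) p"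
  shows "partial_x (\<lambda>p. v p * (w p)\<^sup>2) =
    (\<lambda>p. 2 * partial_x (packet (3 / N ^ 4) 3 N (\<beta> * N ^ 3)) p +
       (partial_x (packet (3 / N ^ 4) 3 (3 * N) ((\<beta> + 2 * \<gamma>) * N ^ 3)) p +
        partial_x (packet (3 / N ^ 4) 3 (- N) ((\<beta> - 2 * \<gamma>) * N ^ 3)) p))"
proof -
  let ?p = "packet (3 / N ^ 4) 3"
  have a: "1 / N ^ 4 + 1 / N ^ 4 + 1 / N ^ 4 = 3 / N ^ 4" by simp
  have "v p * (w p)\<^sup>2 = 2 * ?p N (\<beta> * N ^ 3) p +
      (?p (3 * N) ((\<beta> + 2 * \<gamma>) * N ^ 3) p + ?p (- N) ((\<beta> - 2 * \<gamma>) * N ^ 3) p)" for p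
  proof -
    let ?a = "packet (1 / N ^ 4) 1 N (\<gamma> * N ^ 3) p" and ?b = "packet (1 / N ^ 4) 1 (- N) (- (\<gamma> * N ^ 3)) p"
    \<comment> \<open>In the cross term the opposite modulations cancel, which returns the product
      to the centre of v: this is the resonance, with multiplicity 2. The two squares land at 3N and
      -N.\<close>
    have "v p * (w p)\<^sup>2 = 2 * (v p * ?a * ?b) + (v p * ?a * ?a + v p * ?b * ?b)"
      by (simp add: w_def power2_eq_square algebra_simps)
    then show ?thesis
      unfolding v_def packet_mult a by (simp add: algebra_simps)
  qed
  then have eq: "(\<lambda>p. v p * (w p)\<^sup>2) = (\<lambda>p. 2 * ?p N (\<beta> * N ^ 3) p +
      (?p (3 * N) ((\<beta> + 2 * \<gamma>) * N ^ 3) p + ?p (- N) ((\<beta> - 2 * \<gamma>) * N ^ 3) p))" by auto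
  have d: "((\<lambda>y. packet a d A B (y, t)) has_vector_derivative partial_x (packet a d A B) (x, t)) (at x)"
    for a d A B x t
    using packet_has_vector_derivative[of a d A B t x]
    unfolding partial_x_packet by (simp add: packet_def mult.assoc)
  show ?thesis
    unfolding eq
    by (rule partial_x_eqI) (intro has_vector_derivative_add has_vector_derivative_mult_right d)
qed

text \<open>All three packets carry the same complex factor \<open>\<i> * \<xi> * c\<close> and
  nonnegative real amplitudes, so the norm of the sum is the sum of the norms.\<close>

lemma fourier2_output:
  fixes N \<beta> \<gamma> :: real
  assumes N: "N > 0"
  defines "v \<equiv> packet (1 / N ^ 4) 1 N (\<beta> * N ^ 3)"
    and "w \<equiv> \<lambda>p. packet (1 / N ^ 4) 1 N (\<gamma> * N ^ 3) p + packet (1 / N ^ 4) 1 (- N) (- (\<gamma> * N ^ 3)) p"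
  shows "norm (fourier2 c (partial_x (\<lambda>p. v p * (w p)\<^sup>2)) q) =
    norm c * \<bar>fst q\<bar> * (2 * packet_hat (3 / N ^ 4) 3 N (\<beta> * N ^ 3) q +
       (packet_hat (3 / N ^ 4) 3 (3 * N) ((\<beta> + 2 * \<gamma>) * N ^ 3) q +
        packet_hat (3 / N ^ 4) 3 (- N) ((\<beta> - 2 * \<gamma>) * N ^ 3) q))"
proof -
  let ?H = "packet_hat (3 / N ^ 4) 3"
  have a: "3 / N ^ 4 > 0" "(3::real) > 0" using N by auto
  obtain \<xi> \<tau> where q: "q = (\<xi>, \<tau>)" by force
  have nn: "?H A B q \<ge> 0" for A B using a by (rule packet_hat_nonneg)
  have "fourier2 c (partial_x (\<lambda>p. v p * (w p)\<^sup>2)) q = \<i> * of_real \<xi> * c *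
    of_real (2 * ?H N (\<beta> * N ^ 3) q + (?H (3 * N) ((\<beta> + 2 * \<gamma>) * N ^ 3) q + ?H (- N) ((\<beta> - 2 * \<gamma>) * N ^ 3) q))"
    unfolding v_def w_def partial_x_output
    by (subst fourier2_add fourier2_cmult
        | intro integrable_mult_right Bochner_Integration.integrable_add integrable_partial_x_packet a)+
      (simp add: q fourier2_partial_x_packet[OF a] algebra_simps)
  then show ?thesis using nn by (simp add: norm_mult q del: of_real_add of_real_mult)
qed

text \<open>Needed for the lower bound: a non-integrable integrand would have the default integral
  0, and comparison from below would break down.\<close>

lemma integrable_output:
  fixes N \<beta> \<gamma> s b :: real
  assumes s: "s \<le> 0" and N: "N \<ge> 1"
  defines "H \<equiv> \<lambda>q. 2 * packet_hat (3 / N ^ 4) 3 N (\<beta> * N ^ 3) q +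
       (packet_hat (3 / N ^ 4) 3 (3 * N) ((\<beta> + 2 * \<gamma>) * N ^ 3) q +
        packet_hat (3 / N ^ 4) 3 (- N) ((\<beta> - 2 * \<gamma>) * N ^ 3) q)"
  shows "integrable lborel (\<lambda>q. (X_weight \<beta> s b q * (C * \<bar>fst q\<bar> * H q))\<^sup>2)"
proof -
  \<comment> \<open>The two non-resonant packets may lie far off the curve. Their distance may
    depend on N, since integrability is claimed for one N at a time.\<close>
  define D where "D = \<bar>(\<beta> + 2 * \<gamma>) * N ^ 3 - \<beta> * (3 * N) ^ 3\<bar> + \<bar>(\<beta> - 2 * \<gamma>) * N ^ 3 - \<beta> * (- N) ^ 3\<bar>"
  obtain K where K: "K > 0"
    "\<And>N A B k q. 1 \<le> N \<Longrightarrow> N \<le> \<bar>A\<bar> \<Longrightarrow> \<bar>A\<bar> \<le> 3 * N \<Longrightarrow> \<bar>B - \<beta> * A ^ 3\<bar> \<le> D \<Longrightarrow> 1 \<le> k \<Longrightarrow> k \<le> 3 \<Longrightarrow>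
      (X_weight \<beta> s b q * ((1 + \<bar>N\<^sup>2 * (fst q - A)\<bar>) * packet_hat (k / N ^ 4) k A B q))\<^sup>2
        \<le> (K * N powr (s + 2))\<^sup>2 * majorant N A B q"
    using packet_weight_bound[OF s, of \<beta> D b] by metis
  define R where "R = (3 * N)\<^sup>2 * (K * N powr (s + 2))\<^sup>2"
  have pw: "(X_weight \<beta> s b q * (\<bar>fst q\<bar> * packet_hat (3 / N ^ 4) 3 A B q))\<^sup>2 \<le> R * majorant N A B q"
    if A: "N \<le> \<bar>A\<bar>" "\<bar>A\<bar> \<le> 3 * N" "\<bar>B - \<beta> * A ^ 3\<bar> \<le> D" for A B q
  proof -
    have "\<bar>fst q - A\<bar> \<le> \<bar>N\<^sup>2 * (fst q - A)\<bar>"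
      using N mult_right_mono[of 1 "N\<^sup>2" "\<bar>fst q - A\<bar>"] by (simp add: abs_mult)
    then have "\<bar>fst q\<bar> \<le> 3 * N * 1 + 1 * \<bar>N\<^sup>2 * (fst q - A)\<bar>" using A by linarith
    also have "\<dots> \<le> 3 * N * 1 + 3 * N * \<bar>N\<^sup>2 * (fst q - A)\<bar>"
      using N by (intro add_left_mono mult_right_mono) auto
    finally have le: "\<bar>fst q\<bar> \<le> 3 * N * (1 + \<bar>N\<^sup>2 * (fst q - A)\<bar>)" by (simp only: distrib_left)
    let ?H = "packet_hat (3 / N ^ 4) 3 A B q"
    have H: "?H \<ge> 0" using N by (intro packet_hat_nonneg) auto
    have "X_weight \<beta> s b q * (\<bar>fst q\<bar> * ?H) \<le> X_weight \<beta> s b q * ((3 * N * (1 + \<bar>N\<^sup>2 * (fst q - A)\<bar>)) * ?H)"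
      using le H by (intro mult_left_mono mult_right_mono X_weight_nonneg) auto
    also have "\<dots> = 3 * N * (X_weight \<beta> s b q * ((1 + \<bar>N\<^sup>2 * (fst q - A)\<bar>) * ?H))"
      by (simp only: mult_ac)
    finally have "(X_weight \<beta> s b q * (\<bar>fst q\<bar> * ?H))\<^sup>2 \<le> (3 * N * (X_weight \<beta> s b q * ((1 + \<bar>N\<^sup>2 * (fst q - A)\<bar>) * ?H)))\<^sup>2"
      using H by (intro power_mono mult_nonneg_nonneg X_weight_nonneg) auto
    also have "\<dots> \<le> (3 * N)\<^sup>2 * ((K * N powr (s + 2))\<^sup>2 * majorant N A B q)"
      unfolding power_mult_distrib[of "3 * N"] using K(2)[OF N A, of 3 q]
      by (intro mult_left_mono) auto
    also have "\<dots> = R * majorant N A B q"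
      by (simp only: R_def mult.assoc)
    finally show ?thesis .
  qed
  let ?m1 = "majorant N N (\<beta> * N ^ 3)" and ?m2 = "majorant N (3 * N) ((\<beta> + 2 * \<gamma>) * N ^ 3)"
    and ?m3 = "majorant N (- N) ((\<beta> - 2 * \<gamma>) * N ^ 3)"
  let ?G = "\<lambda>q. C\<^sup>2 * (3 * (4 * (R * ?m1 q) + (R * ?m2 q + R * ?m3 q)))"
  show ?thesis
  proof (rule Bochner_Integration.integrable_bound)
    show "integrable lborel ?G"
      by (intro integrable_mult_right Bochner_Integration.integrable_add integrable_majorant N)
    show "(\<lambda>q. (X_weight \<beta> s b q * (C * \<bar>fst q\<bar> * H q))\<^sup>2) \<in> borel_measurable lborel"
      unfolding H_def measurable_lborel1 by measurable
    show "AE q in lborel. norm ((X_weight \<beta> s b q * (C * \<bar>fst q\<bar> * H q))\<^sup>2) \<le> norm (?G q)"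
    proof (rule AE_I2)
      fix q :: "real \<times> real"
      let ?T = "\<lambda>A B. X_weight \<beta> s b q * (\<bar>fst q\<bar> * packet_hat (3 / N ^ 4) 3 A B q)"
      have sq: "(2 * x + (y + z))\<^sup>2 \<le> 3 * (4 * x\<^sup>2 + (y\<^sup>2 + z\<^sup>2))" for x y z :: real
        using zero_le_power2[of "2 * x - y"] zero_le_power2[of "2 * x - z"] zero_le_power2[of "y - z"]
        by (simp add: power2_eq_square algebra_simps)
      have "(X_weight \<beta> s b q * (C * \<bar>fst q\<bar> * H q))\<^sup>2 = C\<^sup>2 * (2 * ?T N (\<beta> * N ^ 3) +
          (?T (3 * N) ((\<beta> + 2 * \<gamma>) * N ^ 3) + ?T (- N) ((\<beta> - 2 * \<gamma>) * N ^ 3)))\<^sup>2"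
        unfolding power_mult_distrib[symmetric] by (simp add: H_def algebra_simps)
      also have "\<dots> \<le> ?G q"
      proof (intro mult_left_mono order_trans[OF sq] add_mono pw zero_le_power2)
        show "\<bar>\<beta> * N ^ 3 - \<beta> * N ^ 3\<bar> \<le> D" by (simp add: D_def)
        show "\<bar>(\<beta> + 2 * \<gamma>) * N ^ 3 - \<beta> * (3 * N) ^ 3\<bar> \<le> D" unfolding D_def by linarith
        show "\<bar>(\<beta> - 2 * \<gamma>) * N ^ 3 - \<beta> * (- N) ^ 3\<bar> \<le> D" unfolding D_def by linarith
      qed (use N in auto)
      finally show "norm ((X_weight \<beta> s b q * (C * \<bar>fst q\<bar> * H q))\<^sup>2) \<le> norm (?G q)"
        by simp
    qed
  qed
qed

text \<open>On a rectangle of area 4 / N^2 around the resonant centre the weight is at least of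
  order N^s, the derivative of order N and the packet of order N^2. So the integrand is at least of
  order N^(2s+6) there, while the other packets can only add to it.\<close>

lemma X_norm_output_ge:
  fixes \<beta> \<gamma> s b :: real and c :: complex
  assumes s: "s \<le> 0" and c: "c \<noteq> 0"
  obtains \<kappa> where "\<kappa> > 0"
    "\<And>N. 2 \<le> N \<Longrightarrow> \<kappa> * N powr (s + 2) \<le> X_norm c \<beta> s b (partial_x (\<lambda>p. packet (1 / N ^ 4) 1 N (\<beta> * N ^ 3) p *
       (packet (1 / N ^ 4) 1 N (\<gamma> * N ^ 3) p + packet (1 / N ^ 4) 1 (- N) (- (\<gamma> * N ^ 3)) p)\<^sup>2))"
proof -
  obtain M :: nat where M: "\<bar>b\<bar> \<le> real M" by (meson real_arch_simple)
  \<comment> \<open>On the rectangle both rescaled offsets are at most 1, which makes the last two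
    factors in \<open>jbracket_le\<close> at most 2 and 2^3.\<close>
  define L where "L = ((1 + 27 * \<bar>\<beta>\<bar>) * 2 * 2 ^ 3) ^ M"
  have L: "L > 0" by (auto simp: L_def intro!: zero_less_power add_pos_nonneg)
  \<comment> \<open>The factors bound, in order: the dispersive weight; the weight in \<xi>, via
    \<open>jbracket \<xi> \<le> 3 * N\<close>; the derivative, via
    \<open>N / 2 \<le> \<bar>\<xi>\<bar>\<close>; and the resonant packet with its multiplicity 2,
    where exp(-1/3) is exp(-1/6) from each variable.\<close>
  define \<delta> where "\<delta> = 1 / L * 3 powr s * (norm c * (1 / 2) * (2 * (2 * pi / 3 * exp (- 1 / 3))))"
  have \<delta>: "\<delta> > 0" using L c by (simp add: \<delta>_def)
  show thesis
  proof (rule that[of "2 * \<delta>"])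
    show "2 * \<delta> > 0" using \<delta> by simp
    fix N :: real assume N: "2 \<le> N"
    let ?H = "packet_hat (3 / N ^ 4) 3"
    define H where "H = (\<lambda>q. 2 * ?H N (\<beta> * N ^ 3) q +
       (?H (3 * N) ((\<beta> + 2 * \<gamma>) * N ^ 3) q + ?H (- N) ((\<beta> - 2 * \<gamma>) * N ^ 3) q))"
    define Q where "Q = cbox (N - 1 / N\<^sup>2, \<beta> * N ^ 3 - 1) (N + 1 / N\<^sup>2, \<beta> * N ^ 3 + 1)"
    define F where "F = (\<lambda>q. (X_weight \<beta> s b q * (norm c * \<bar>fst q\<bar> * H q))\<^sup>2)"
    have nn: "?H A B q \<ge> 0" for A B q using N by (intro packet_hat_nonneg) auto
    have Qm: "measure lborel Q = 4 / N\<^sup>2"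
      unfolding Q_def content_Pair using N by (simp add: content_real)
    have low: "(\<delta> * N powr (s + 3))\<^sup>2 \<le> F q" if "q \<in> Q" for q
    proof -
      obtain \<xi> \<tau> where q: "q = (\<xi>, \<tau>)" by force
      have N1: "1 \<le> N" using N by simp
      have \<xi>: "\<bar>\<xi> - N\<bar> \<le> 1 / N\<^sup>2" and \<tau>: "\<bar>\<tau> - \<beta> * N ^ 3\<bar> \<le> 1"
        using that by (auto simp: Q_def q cbox_Pair_eq abs_le_iff)
      then have x: "\<bar>N\<^sup>2 * (\<xi> - N)\<bar> \<le> 1" using N by (simp only: abs_mult) (simp add: pos_le_divide_eq mult.commute)
      have "1 / N\<^sup>2 \<le> 1" using N by (simp add: one_le_power)
      then have \<xi>': "\<bar>\<xi> - N\<bar> \<le> 1" using \<xi> by linarith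
      have "jbracket (\<tau> - \<beta> * \<xi> ^ 3) \<le> (1 + 0 + 27 * \<bar>\<beta>\<bar>) * (1 + \<bar>\<tau> - \<beta> * N ^ 3\<bar>) * (1 + \<bar>N\<^sup>2 * (\<xi> - N)\<bar>) ^ 3"
        using N by (intro jbracket_le) auto
      also have "\<dots> \<le> (1 + 27 * \<bar>\<beta>\<bar>) * 2 * 2 ^ 3"
        using x \<tau> by (intro mult_mono power_mono mult_nonneg_nonneg) auto
      finally have w1: "1 / L \<le> jbracket (\<tau> - \<beta> * \<xi> ^ 3) powr b"
        unfolding L_def by (intro powr_le_power jbracket_ge_1 M)
      have w2: "3 powr s * N powr s \<le> jbracket \<xi> powr s"
      proof -
        have "jbracket \<xi> \<le> 3 * N" using \<xi>' N unfolding jbracket_def by linarith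
        then have "(3 * N) powr s \<le> jbracket \<xi> powr s"
          using s jbracket_ge_1[of \<xi>] by (intro powr_mono2') auto
        then show ?thesis using N by (simp add: powr_mult)
      qed
      have w3: "N / 2 \<le> \<bar>\<xi>\<bar>" using \<xi>' N by linarith
      have w4: "2 * pi / 3 * N\<^sup>2 * exp (- 1 / 3) \<le> ?H N (\<beta> * N ^ 3) q"
      proof -
        have e: "exp (- 1 / 6) \<le> exp (- y\<^sup>2 / (2 * 3))" if "\<bar>y\<bar> \<le> 1" for y :: real
          using that by (simp add: abs_square_le_1)
        have sq: "(N\<^sup>2 * (\<xi> - N))\<^sup>2 = N ^ 4 * (\<xi> - N)\<^sup>2" by (simp add: power_mult_distrib)
        have "sqrt (2 * pi / (3 / N ^ 4)) * sqrt (2 * pi / 3) = sqrt ((2 * pi / 3 * N\<^sup>2)\<^sup>2)"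
          unfolding real_sqrt_mult[symmetric] by (simp add: power2_eq_square power4_eq_xxxx)
        also have "\<dots> = 2 * pi / 3 * N\<^sup>2" by simp
        finally have "?H N (\<beta> * N ^ 3) q = 2 * pi / 3 * N\<^sup>2 *
            (exp (- (N\<^sup>2 * (\<xi> - N))\<^sup>2 / (2 * 3)) * exp (- (\<tau> - \<beta> * N ^ 3)\<^sup>2 / (2 * 3)))"
          unfolding packet_hat_def q case_prod_conv sq by (simp add: mult_ac)
        also have "\<dots> \<ge> 2 * pi / 3 * N\<^sup>2 * (exp (- 1 / 6) * exp (- 1 / 6))"
          by (intro mult_left_mono mult_mono e x \<tau>) auto
        finally show ?thesis by (simp add: exp_add[symmetric])
      qed
      have "\<delta> * N powr (s + 3) = (1 / L * (3 powr s * N powr s)) * (norm c * (N / 2) * (2 * (2 * pi / 3 * N\<^sup>2 * exp (- 1 / 3))))"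
        using N by (simp add: \<delta>_def powr_add power2_eq_square power3_eq_cube)
      also have "\<dots> \<le> X_weight \<beta> s b q * (norm c * \<bar>fst q\<bar> * H q)"
      proof (rule mult_mono)
        show "1 / L * (3 powr s * N powr s) \<le> X_weight \<beta> s b q"
          unfolding X_weight_def q case_prod_conv using L by (intro mult_mono w1 w2) auto
        show "norm c * (N / 2) * (2 * (2 * pi / 3 * N\<^sup>2 * exp (- 1 / 3))) \<le> norm c * \<bar>fst q\<bar> * H q"
        proof (rule mult_mono)
          show "norm c * (N / 2) \<le> norm c * \<bar>fst q\<bar>"
            using w3 q by (intro mult_left_mono) auto
          show "2 * (2 * pi / 3 * N\<^sup>2 * exp (- 1 / 3)) \<le> H q"
            using w4 nn[of "3 * N" "(\<beta> + 2 * \<gamma>) * N ^ 3" q] nn[of "- N" "(\<beta> - 2 * \<gamma>) * N ^ 3" q]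
            unfolding H_def by linarith
        qed auto
      qed (use N in \<open>auto intro: X_weight_nonneg\<close>)
      finally show ?thesis
        unfolding F_def using \<delta> by (intro power_mono) auto
    qed
    have "(\<delta> * N powr (s + 3))\<^sup>2 * (4 / N\<^sup>2) = (LINT q|lborel. (\<delta> * N powr (s + 3))\<^sup>2 * indicator Q q)"
      using Qm by simp
    also have "\<dots> \<le> (LINT q|lborel. F q)"
    proof (rule integral_mono')
      show "integrable lborel F"
        unfolding F_def H_def using N by (intro integrable_output s) auto
    qed (use low in \<open>auto simp: F_def split: split_indicator\<close>)
    finally have "sqrt ((\<delta> * N powr (s + 3))\<^sup>2 * (4 / N\<^sup>2)) \<le> sqrt (LINT q|lborel. F q)"
      by (rule real_sqrt_le_mono)
    moreover have "sqrt ((\<delta> * N powr (s + 3))\<^sup>2 * (4 / N\<^sup>2)) = 2 * \<delta> * N powr (s + 2)"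
    proof -
      have "N powr (s + 3) = N powr (s + 2) * N"
        using powr_add[of N "s + 2" 1] N by (simp add: add.assoc)
      then have "(\<delta> * N powr (s + 3))\<^sup>2 * (4 / N\<^sup>2) = (2 * \<delta> * N powr (s + 2))\<^sup>2"
        using N by (simp add: power_mult_distrib)
      then show ?thesis using \<delta> by simp
    qed
    ultimately have "2 * \<delta> * N powr (s + 2) \<le> sqrt (LINT q|lborel. F q)" by (simp only:)
    then show "2 * \<delta> * N powr (s + 2) \<le> X_norm c \<beta> s b (partial_x (\<lambda>p. packet (1 / N ^ 4) 1 N (\<beta> * N ^ 3) p *
       (packet (1 / N ^ 4) 1 N (\<gamma> * N ^ 3) p + packet (1 / N ^ 4) 1 (- N) (- (\<gamma> * N ^ 3)) p)\<^sup>2))"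
      using N unfolding X_norm_eq F_def H_def by (subst fourier2_output) auto
  qed
qed

text \<open>The output is of order at least N^(s+2), the right-hand side of order at most N^(3s+3).
  Keeping \<beta> and \<gamma> arbitrary lets one argument serve both estimates.\<close>

lemma trilinear_estimate_fails:
  fixes \<beta> \<gamma> s b b' C :: real and c :: complex
  assumes c: "c \<noteq> 0" and s: "s < - 1 / 2"
  shows "\<exists>v w. schwartz v \<and> schwartz w \<and>
    C * (X_norm c \<beta> s b v * (X_norm c \<gamma> s b w)\<^sup>2) < X_norm c \<beta> s b' (partial_x (\<lambda>p. v p * (w p)\<^sup>2))"
proof -
  have s0: "s \<le> 0" using s by simp
  define v where "v = (\<lambda>N::real. packet (1 / N ^ 4) 1 N (\<beta> * N ^ 3))"
  define w where "w = (\<lambda>N::real. \<lambda>p. packet (1 / N ^ 4) 1 N (\<gamma> * N ^ 3) p + packet (1 / N ^ 4) 1 (- N) (- (\<gamma> * N ^ 3)) p)"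
  obtain K1 where K1: "K1 \<ge> 0" "\<And>N. 1 \<le> N \<Longrightarrow> X_norm c \<beta> s b (v N) \<le> K1 * N powr (s + 1)"
    using X_norm_packet_le[OF s0, of c \<beta> b] unfolding v_def by metis
  obtain K2 where K2: "K2 \<ge> 0" "\<And>N. 1 \<le> N \<Longrightarrow> X_norm c \<gamma> s b (w N) \<le> K2 * N powr (s + 1)"
    using X_norm_packet_le[OF s0, of c \<gamma> b] unfolding w_def by metis
  obtain \<kappa> where \<kappa>: "\<kappa> > 0"
    "\<And>N. 2 \<le> N \<Longrightarrow> \<kappa> * N powr (s + 2) \<le> X_norm c \<beta> s b' (partial_x (\<lambda>p. v N p * (w N p)\<^sup>2))"
    unfolding v_def w_def by (rule X_norm_output_ge[OF s0 c, where \<beta> = \<beta> and \<gamma> = \<gamma> and b = b']) blast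
  have Xnn: "X_norm c \<beta> s b f \<ge> 0" for \<beta> f
    unfolding X_norm_eq by (intro real_sqrt_ge_zero integral_nonneg_AE) auto
  \<comment> \<open>This is (s + 2) - (3s + 3), positive exactly because s < -1/2. Below, P is the
    threshold that N^e must exceed; it contains |C| because C may be negative.\<close>
  define e where "e = - 1 - 2 * s"
  have e: "e > 0" using s by (simp add: e_def)
  define P where "P = \<bar>C\<bar> * K1 * K2\<^sup>2 / \<kappa>"
  have "filterlim (\<lambda>N. N powr e) at_top at_top" using e by real_asymp
  then have "eventually (\<lambda>N. N powr e > P) at_top" by (simp add: filterlim_at_top_dense)
  then have "eventually (\<lambda>N. N powr e > P \<and> N \<ge> 2) at_top" by (intro eventually_conj eventually_ge_at_top)
  then obtain N where N: "N powr e > P" "N \<ge> 2" by (auto simp: eventually_at_top_linorder)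
  have "C * (X_norm c \<beta> s b (v N) * (X_norm c \<gamma> s b (w N))\<^sup>2) \<le>
      \<bar>C\<bar> * ((K1 * N powr (s + 1)) * (K2 * N powr (s + 1))\<^sup>2)"
    using N K1 K2 Xnn by (intro mult_mono power_mono mult_nonneg_nonneg) auto
  also have "\<dots> = P * \<kappa> * N powr (3 * s + 3)"
  proof -
    have "N powr (3 * s + 3) = N powr ((s + 1) + (s + 1) + (s + 1))" by (simp add: algebra_simps)
    also have "\<dots> = N powr (s + 1) * (N powr (s + 1))\<^sup>2"
      by (simp only: powr_add power2_eq_square mult.assoc)
    finally show ?thesis using \<kappa>(1) by (simp add: P_def power_mult_distrib)
  qed
  also have "\<dots> < N powr e * \<kappa> * N powr (3 * s + 3)"
    using N \<kappa>(1) by (intro mult_strict_right_mono) auto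
  also have "\<dots> = \<kappa> * N powr (s + 2)"
    by (simp add: e_def flip: powr_add)
  also have "\<dots> \<le> X_norm c \<beta> s b' (partial_x (\<lambda>p. v N p * (w N p)\<^sup>2))"
    using N by (intro \<kappa>)
  finally have "C * (X_norm c \<beta> s b (v N) * (X_norm c \<gamma> s b (w N))\<^sup>2) < X_norm c \<beta> s b' (partial_x (\<lambda>p. v N p * (w N p)\<^sup>2))" .
  moreover have "schwartz (v N)" "schwartz (w N)"
    unfolding v_def w_def using N
    by (intro schwartz_gauss_poly gauss_poly.add packet_in_gauss_poly; simp)+
  ultimately show ?thesis by blast
qed

theorem proposition1p2:
  fixes \<alpha> s b b' :: real and c :: complex
  assumes "c \<noteq> 0" and "0 < \<alpha>" and "\<alpha> < 1" and "s < - 1 / 2"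
  shows "\<not> (\<exists>C::real. \<forall>v w. schwartz v \<longrightarrow> schwartz w \<longrightarrow>
            X_norm c 1 s b' (partial_x (\<lambda>p. v p * (w p)\<^sup>2))
              \<le> C * (X_norm c 1 s b v * (X_norm c \<alpha> s b w)\<^sup>2)) \<and>
         \<not> (\<exists>C::real. \<forall>v w. schwartz v \<longrightarrow> schwartz w \<longrightarrow>
            X_norm c \<alpha> s b' (partial_x (\<lambda>p. (v p)\<^sup>2 * w p))
              \<le> C * ((X_norm c 1 s b v)\<^sup>2 * X_norm c \<alpha> s b w))"
proof (intro conjI notI)
  assume "\<exists>C::real. \<forall>v w. schwartz v \<longrightarrow> schwartz w \<longrightarrow>
            X_norm c 1 s b' (partial_x (\<lambda>p. v p * (w p)\<^sup>2))
              \<le> C * (X_norm c 1 s b v * (X_norm c \<alpha> s b w)\<^sup>2)"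
  then show False
    using trilinear_estimate_fails[OF assms(1,4)] by (meson not_less)
next
  assume "\<exists>C::real. \<forall>v w. schwartz v \<longrightarrow> schwartz w \<longrightarrow>
            X_norm c \<alpha> s b' (partial_x (\<lambda>p. (v p)\<^sup>2 * w p))
              \<le> C * ((X_norm c 1 s b v)\<^sup>2 * X_norm c \<alpha> s b w)"
  \<comment> \<open>The second estimate is the same failure with \<alpha> and 1 interchanged and the
    roles of v and w swapped; commuting the squared factor to the right makes the shapes
    agree.\<close>
  then show False
    using trilinear_estimate_fails[OF assms(1,4)] by (simp only: mult.commute[of "_\<^sup>2"]) (meson not_less)
qed

end
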